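(* Let $N\ge1$, $\underline d\in\mathbb N^{N+1}$, and let $\underline d'=(d'_0\le\dots\le d'_N)$ be its weakly increasing reordering. Consider the quadratic integer program $$\min\ G_{\underline d}(\underline e)=\sum_{1\le j\le i\le N}e_i\,(e_j+d'_j-d'_{j-1})\quad\text{over }\underline e=(e_1,\dots,e_N)\in\mathbb N^N\text{ with }\sum_{i=1}^Ne_i=d'_0.$$ Then the codimension in $\mathrm{Rep}_{\underline d}$ of $\Sigma^0_{\underline d}$ (i.e. of its top-dimensional irreducible components) equals the minimum value of this program, and the number of top-dimensional irreducible components of $\Sigma^0_{\underline d}$ equals the number of $\underline e$ at which the minimum is attained.
   Context: Work over $\mathbb C$. $\mathrm{Rep}_{\underline d}=\prod_{i=1}^N\mathrm{Mat}_{d_i,d_{i-1}}$ is the space of tuples $A_*=(A_1,\dots,A_N)$ with $A_i$ a $d_i\times d_{i-1}$ matrix, and $\Sigma^0_{\underline d}=\{A_*\in\mathrm{Rep}_{\underline d}: A_NA_{N-1}\cdots A_1=0\}$. *)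

theory Defs
  imports Complex_Main
begin

text \<open>A point of Rep_d is encoded as a function A with A i r c the (r,c) entry of
 the matrix A_i (1 \<le> i \<le> N, r < d i, c < d (i-1)); all other entries are 0.\<close>

type_synonym rep = "nat \<Rightarrow> nat \<Rightarrow> nat \<Rightarrow> complex"

definition Rep :: "nat \<Rightarrow> (nat \<Rightarrow> nat) \<Rightarrow> rep set" where
  "Rep N d = {A. \<forall>i r c. \<not> (1 \<le> i \<and> i \<le> N \<and> r < d i \<and> c < d (i - 1)) \<longrightarrow> A i r c = 0}"

fun prodmat :: "(nat \<Rightarrow> nat) \<Rightarrow> rep \<Rightarrow> nat \<Rightarrow> nat \<Rightarrow> nat \<Rightarrow> complex" where
  "prodmat d A 0 r c = (if r = c then 1 else 0)"
| "prodmat d A (Suc k) r c = (\<Sum>m<d k. A (Suc k) r m * prodmat d A k m c)"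

definition Sigma0 :: "nat \<Rightarrow> (nat \<Rightarrow> nat) \<Rightarrow> rep set" where
  "Sigma0 N d = {A \<in> Rep N d. \<forall>r < d N. \<forall>c < d 0. prodmat d A N r c = 0}"

inductive_set polyfun :: "(rep \<Rightarrow> complex) set" where
  const: "(\<lambda>A. a) \<in> polyfun"
| coord: "(\<lambda>A. A i r c) \<in> polyfun"
| add: "f \<in> polyfun \<Longrightarrow> g \<in> polyfun \<Longrightarrow> (\<lambda>A. f A + g A) \<in> polyfun"
| mult: "f \<in> polyfun \<Longrightarrow> g \<in> polyfun \<Longrightarrow> (\<lambda>A. f A * g A) \<in> polyfun"

definition zclosed :: "nat \<Rightarrow> (nat \<Rightarrow> nat) \<Rightarrow> rep set \<Rightarrow> bool" where
  "zclosed N d S \<longleftrightarrow> (\<exists>F \<subseteq> polyfun. S = {A \<in> Rep N d. \<forall>f\<in>F. f A = 0})"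

definition zirred :: "nat \<Rightarrow> (nat \<Rightarrow> nat) \<Rightarrow> rep set \<Rightarrow> bool" where
  "zirred N d Z \<longleftrightarrow> zclosed N d Z \<and> Z \<noteq> {} \<and>
     (\<forall>S T. zclosed N d S \<longrightarrow> zclosed N d T \<longrightarrow> Z = S \<union> T \<longrightarrow> Z = S \<or> Z = T)"

definition zdim :: "nat \<Rightarrow> (nat \<Rightarrow> nat) \<Rightarrow> rep set \<Rightarrow> nat" where
  "zdim N d X = Sup {n. \<exists>Z :: nat \<Rightarrow> rep set. (\<forall>i\<le>n. zirred N d (Z i)) \<and>
      (\<forall>i<n. Z i \<subset> Z (Suc i)) \<and> Z n \<subseteq> X}"

definition irr_components :: "nat \<Rightarrow> (nat \<Rightarrow> nat) \<Rightarrow> rep set \<Rightarrow> rep set set" where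
  "irr_components N d X = {Z. Z \<subseteq> X \<and> zirred N d Z \<and>
      (\<forall>W. zirred N d W \<longrightarrow> Z \<subseteq> W \<longrightarrow> W \<subseteq> X \<longrightarrow> W = Z)}"

definition top_components :: "nat \<Rightarrow> (nat \<Rightarrow> nat) \<Rightarrow> rep set \<Rightarrow> rep set set" where
  "top_components N d X = {Z \<in> irr_components N d X. zdim N d Z = zdim N d X}"

definition dsorted :: "nat \<Rightarrow> (nat \<Rightarrow> nat) \<Rightarrow> nat \<Rightarrow> nat" where
  "dsorted N d j = sort (map d [0..<Suc N]) ! j"

definition Gobj :: "nat \<Rightarrow> (nat \<Rightarrow> nat) \<Rightarrow> (nat \<Rightarrow> nat) \<Rightarrow> nat" where
  "Gobj N d e = (\<Sum>i=1..N. \<Sum>j=1..i.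
      e i * (e j + dsorted N d j - dsorted N d (j - 1)))"

definition feasible :: "nat \<Rightarrow> (nat \<Rightarrow> nat) \<Rightarrow> (nat \<Rightarrow> nat) set" where
  "feasible N d = {e. (\<forall>i. (i = 0 \<or> N < i) \<longrightarrow> e i = 0) \<and> (\<Sum>i=1..N. e i) = dsorted N d 0}"

end

theory Submission
  imports Defs "Jordan_Normal_Form.Determinant" "HOL-Computational_Algebra.Polynomial" "HOL-Library.FuncSet"
begin

text \<open>Stratify \<open>Sigma0 N d\<close> by the ranks \<open>r k\<close> of the partial products \<open>A\<^sub>k \<cdots> A\<^sub>1\<close>. Given the image of
  \<open>A\<^sub>k\<^sub>-\<^sub>1 \<cdots> A\<^sub>1\<close>, the matrix \<open>A\<^sub>k\<close> only has to have rank \<open>r k\<close> on it, so each stratum is rationally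
  parametrised by an affine space, its closure is irreducible, and its codimension is
  \<open>\<Sum>k. (d k - r k) (r (k - 1) - r k)\<close>. For weakly increasing \<open>d\<close> this is the objective function at
  \<open>e k = r (k - 1) - r k\<close>.

  For general \<open>d\<close> the minimum and the number of minimisers are invariant under permutations of \<open>d\<close>:
  they are the leading exponent and coefficient, as \<open>q\<close> tends to infinity, of the probability that a
  product of random matrices over the field with \<open>q\<close> elements vanishes. This probability is symmetric
  because the Markov chain of ranks has the eigenfunctions \<open>g\<^sub>j s = \<Prod>i<j. (1 - q\<^sup>i / q\<^sup>s)\<close> with
  eigenvalue \<open>g\<^sub>j d\<close> for each factor with \<open>d\<close> rows, so the expectation of \<open>g\<^sub>j\<close> on the rank of the
  product is \<open>\<Prod>k. g\<^sub>j (d k)\<close>.\<close>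

section \<open>Polynomial functions and irreducible closed sets\<close>

text \<open>Dimension is a supremum of chain lengths, so every stratum closure needs bounds from
  both sides. Above: a chain of length n yields n algebraically independent functions, and counting
  monomials bounds n by the number of parameters. Below: the parametrisation is triangular in three
  blocks of parameters, which gives an explicit chain.

  The obstacle in covering the zero locus is that the parametrisation reaches only points whose
  partial images are graphs over the first \<open>r k\<close> coordinates. Any other point is placed
  on a line where all parameter values but at most one allow a basis exchange towards that standard
  position; functions vanishing at those points vanish on the whole line.

  Permuting \<open>d\<close> changes even the number of strata: there are three for (2,2,1) and two
  for (1,2,2). Only a weighted sum over all strata is symmetric, hence the probabilities. Finite
  fields are mere motivation: the identities concern real \<open>p\<close>, with \<open>p\<close>
  tending to 0. Each stratum contributes a power of \<open>p\<close> with leading coefficient 1, so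
  the coefficient of the lowest power counts minimisers.\<close>

lemma polyfun_sum: "(\<And>x. x \<in> S \<Longrightarrow> f x \<in> polyfun) \<Longrightarrow> (\<lambda>A. \<Sum>x\<in>S. f x A) \<in> polyfun"
proof (induction S rule: infinite_finite_induct)
  case (insert x F)
  then show ?case using polyfun.add[of "f x" "\<lambda>A. \<Sum>x\<in>F. f x A"] by simp
qed (auto intro: polyfun.const)

lemma polyfun_prod: "(\<And>x. x \<in> S \<Longrightarrow> f x \<in> polyfun) \<Longrightarrow> (\<lambda>A. \<Prod>x\<in>S. f x A) \<in> polyfun"
proof (induction S rule: infinite_finite_induct)
  case (insert x F)
  then show ?case using polyfun.mult[of "f x" "\<lambda>A. \<Prod>x\<in>F. f x A"] by simp
qed (auto intro: polyfun.const)

lemma polyfun_diff: "f \<in> polyfun \<Longrightarrow> g \<in> polyfun \<Longrightarrow> (\<lambda>A. f A - g A) \<in> polyfun"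
  using polyfun.add[OF _ polyfun.mult[OF polyfun.const[of "-1"]], of f g] by simp

lemma polyfun_power: "f \<in> polyfun \<Longrightarrow> (\<lambda>A. f A ^ n) \<in> polyfun"
  using polyfun_prod[of "{..<n}" "\<lambda>_. f"] by simp

lemma polyfun_compose:
  assumes "f \<in> polyfun" "\<And>k a c. (\<lambda>X. \<phi> X k a c) \<in> polyfun"
  shows "(\<lambda>X. f (\<phi> X)) \<in> polyfun"
  using assms(1) by induction (auto intro: polyfun.intros assms(2))

section \<open>Degree of polynomial functions along lines\<close>

definition line :: "rep \<Rightarrow> rep \<Rightarrow> complex \<Rightarrow> rep" where
  "line X Y t = (\<lambda>k a c. X k a c + t * Y k a c)"

text \<open>A bound that is uniform over all lines replaces the total degree, so no representation
  by multivariate polynomials has to be chosen.\<close>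

definition line_degree_le :: "(rep \<Rightarrow> complex) \<Rightarrow> nat \<Rightarrow> bool" where
  "line_degree_le f n \<longleftrightarrow> (\<forall>X Y. \<exists>p. degree p \<le> n \<and> (\<forall>t. f (line X Y t) = poly p t))"

lemma line_degree_le_mono: "line_degree_le f m \<Longrightarrow> m \<le> n \<Longrightarrow> line_degree_le f n"
  unfolding line_degree_le_def by (meson le_trans)

lemma line_degree_le_const: "line_degree_le (\<lambda>A. a) 0"
  unfolding line_degree_le_def
proof (intro allI exI conjI)
  show "degree [:a:] \<le> 0" by simp
qed simp

lemma line_degree_le_add:
  assumes "line_degree_le f m" "line_degree_le g m"
  shows "line_degree_le (\<lambda>A. f A + g A) m"
  unfolding line_degree_le_def
proof (intro allI)
  fix X Y
  obtain p q where "degree p \<le> m" "\<forall>t. f (line X Y t) = poly p t"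
      "degree q \<le> m" "\<forall>t. g (line X Y t) = poly q t"
    using assms unfolding line_degree_le_def by meson
  then show "\<exists>p. degree p \<le> m \<and> (\<forall>t. f (line X Y t) + g (line X Y t) = poly p t)"
    by (intro exI[of _ "p + q"]) (auto intro: degree_add_le)
qed

lemma line_degree_le_mult:
  assumes "line_degree_le f m" "line_degree_le g n"
  shows "line_degree_le (\<lambda>A. f A * g A) (m + n)"
  unfolding line_degree_le_def
proof (intro allI)
  fix X Y
  obtain p q where "degree p \<le> m" "\<forall>t. f (line X Y t) = poly p t"
      "degree q \<le> n" "\<forall>t. g (line X Y t) = poly q t"
    using assms unfolding line_degree_le_def by meson
  then show "\<exists>p. degree p \<le> m + n \<and> (\<forall>t. f (line X Y t) * g (line X Y t) = poly p t)"
    by (intro exI[of _ "p * q"]) (auto intro: order.trans[OF degree_mult_le])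
qed

lemma line_degree_le_power:
  assumes "line_degree_le f m"
  shows "line_degree_le (\<lambda>A. f A ^ n) (n * m)"
  using line_degree_le_const[of 1] line_degree_le_mult[OF assms] by (induction n) auto

lemma line_degree_le_sum:
  assumes "\<And>x. x \<in> S \<Longrightarrow> line_degree_le (f x) m"
  shows "line_degree_le (\<lambda>A. \<Sum>x\<in>S. f x A) m"
  using assms
proof (induction S rule: infinite_finite_induct)
  case (insert x F)
  then show ?case using line_degree_le_add[of "f x" m "\<lambda>A. \<Sum>x\<in>F. f x A"] by simp
qed (auto intro: line_degree_le_mono line_degree_le_const)

lemma polyfun_line_degree_le: "f \<in> polyfun \<Longrightarrow> \<exists>n. line_degree_le f n"
proof (induction rule: polyfun.induct)
  case (const a)
  then show ?case using line_degree_le_const by blast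
next
  case (coord i r c)
  have "line_degree_le (\<lambda>A. A i r c) 1"
    unfolding line_degree_le_def line_def
  proof (intro allI)
    fix X Y :: rep
    show "\<exists>p. degree p \<le> 1 \<and> (\<forall>t. X i r c + t * Y i r c = poly p t)"
      by (intro exI[of _ "[:X i r c, Y i r c:]"]) auto
  qed
  then show ?case by blast
next
  case (add f g)
  then obtain m n where "line_degree_le f m" "line_degree_le g n" by blast
  then have "line_degree_le f (max m n)" "line_degree_le g (max m n)"
    by (auto intro: line_degree_le_mono)
  then show ?case using line_degree_le_add by blast
next
  case (mult f g)
  then show ?case using line_degree_le_mult by blast
qed

lemma polyfun_line:
  assumes "f \<in> polyfun"
  obtains p where "\<And>t. f (line X Y t) = poly p t"
  using polyfun_line_degree_le[OF assms] unfolding line_degree_le_def by meson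

text \<open>A univariate polynomial with infinitely many roots is zero. This plays the part of a
  limit argument when a point is approached along a line.\<close>

lemma polyfun_line_eq_0:
  assumes "f \<in> polyfun" "finite T" "\<And>t. t \<notin> T \<Longrightarrow> f (line X Y t) = 0"
  shows "f (line X Y t) = 0"
proof -
  obtain p where p: "\<And>t. f (line X Y t) = poly p t" using polyfun_line[OF assms(1)] by blast
  have "infinite (UNIV - T)" using assms(2) infinite_UNIV_char_0[where 'a=complex] by simp
  moreover have "UNIV - T \<subseteq> {t. poly p t = 0}" using assms(3) p by auto
  ultimately have "p = 0" using poly_roots_finite finite_subset by blast
  then show ?thesis using p by simp
qed

section \<open>Zariski closures and irreducibility\<close>

definition zclosure :: "nat \<Rightarrow> (nat \<Rightarrow> nat) \<Rightarrow> rep set \<Rightarrow> rep set" where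
  "zclosure N d X = {A \<in> Rep N d. \<forall>f\<in>polyfun. (\<forall>B\<in>X. f B = 0) \<longrightarrow> f A = 0}"

lemma zclosed_zclosure: "zclosed N d (zclosure N d X)"
  unfolding zclosed_def zclosure_def
  by (intro exI[of _ "{f \<in> polyfun. \<forall>B\<in>X. f B = 0}"]) auto

lemma subset_zclosure: "X \<subseteq> Rep N d \<Longrightarrow> X \<subseteq> zclosure N d X"
  unfolding zclosure_def by auto

lemma zclosure_vanish:
  "A \<in> zclosure N d X \<Longrightarrow> f \<in> polyfun \<Longrightarrow> (\<And>B. B \<in> X \<Longrightarrow> f B = 0) \<Longrightarrow> f A = 0"
  unfolding zclosure_def by simp

lemma zclosure_minimal:
  assumes "zclosed N d S" "X \<subseteq> S"
  shows "zclosure N d X \<subseteq> S"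
proof -
  obtain F where F: "F \<subseteq> polyfun" "S = {A \<in> Rep N d. \<forall>f\<in>F. f A = 0}"
    using assms(1) unfolding zclosed_def by blast
  show ?thesis
  proof
    fix A assume A: "A \<in> zclosure N d X"
    have "f A = 0" if "f \<in> F" for f
      using A F that assms(2) unfolding zclosure_def by blast
    then show "A \<in> S" using A F(2) unfolding zclosure_def by blast
  qed
qed

lemma zclosed_zeros:
  assumes "zclosed N d Z" "f \<in> polyfun"
  shows "zclosed N d {A \<in> Z. f A = 0}"
proof -
  obtain F where F: "F \<subseteq> polyfun" "Z = {A \<in> Rep N d. \<forall>f\<in>F. f A = 0}"
    using assms(1) unfolding zclosed_def by blast
  then show ?thesis unfolding zclosed_def using assms(2) by (intro exI[of _ "insert f F"]) auto
qed

lemma zclosed_nonmember: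
  assumes "zclosed N d S" "A \<in> Rep N d" "A \<notin> S"
  obtains f where "f \<in> polyfun" "f A \<noteq> 0" "\<And>B. B \<in> S \<Longrightarrow> f B = 0"
  using assms unfolding zclosed_def by blast

lemma zclosed_subset_Rep: "zclosed N d S \<Longrightarrow> S \<subseteq> Rep N d"
  unfolding zclosed_def by auto

lemma zirred_zclosed: "zirred N d Z \<Longrightarrow> zclosed N d Z"
  unfolding zirred_def by simp

lemma zirred_nonempty: "zirred N d Z \<Longrightarrow> Z \<noteq> {}"
  unfolding zirred_def by simp

text \<open>The zero sets of \<open>f\<close> and \<open>g\<close> in \<open>Z\<close> are closed
  and cover \<open>Z\<close>: the vanishing ideal of an irreducible set is prime.\<close>

lemma zirred_prime:
  assumes "zirred N d Z" "f \<in> polyfun" "g \<in> polyfun" "\<And>A. A \<in> Z \<Longrightarrow> f A * g A = 0"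
  shows "(\<forall>A\<in>Z. f A = 0) \<or> (\<forall>A\<in>Z. g A = 0)"
proof -
  have "zclosed N d Z" using zirred_zclosed assms(1) .
  then have "zclosed N d {A \<in> Z. f A = 0}" "zclosed N d {A \<in> Z. g A = 0}"
    using zclosed_zeros assms(2,3) by auto
  moreover have "Z = {A \<in> Z. f A = 0} \<union> {A \<in> Z. g A = 0}" using assms(4) by force
  ultimately have "Z = {A \<in> Z. f A = 0} \<or> Z = {A \<in> Z. g A = 0}"
    using assms(1) unfolding zirred_def by blast
  then show ?thesis by blast
qed

lemma zirred_prime_prod:
  assumes "zirred N d Z" "finite R" "\<And>r. r \<in> R \<Longrightarrow> f r \<in> polyfun"
    and "\<And>A. A \<in> Z \<Longrightarrow> (\<Prod>r\<in>R. f r A) = 0"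
  shows "\<exists>r\<in>R. \<forall>A\<in>Z. f r A = 0"
  using assms(2-)
proof (induction R)
  case empty
  moreover have "Z \<noteq> {}" using zirred_nonempty assms(1) .
  ultimately show ?case by auto
next
  case (insert x R)
  have "(\<forall>A\<in>Z. f x A = 0) \<or> (\<forall>A\<in>Z. (\<Prod>r\<in>R. f r A) = 0)"
    using insert by (intro zirred_prime[OF assms(1)]) (auto intro!: polyfun_prod)
  then show ?case using insert by auto
qed

text \<open>Otherwise choose for each \<open>r\<close> a function vanishing on \<open>C r\<close>
  but not on all of \<open>Z\<close>; the product of these vanishes on \<open>Z\<close>, against
  primality.\<close>

lemma zirred_subset_finite_Union:
  assumes "zirred N d Z" "finite R" "\<And>r. r \<in> R \<Longrightarrow> zclosed N d (C r)" "Z \<subseteq> (\<Union>r\<in>R. C r)"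
  shows "\<exists>r\<in>R. Z \<subseteq> C r"
proof (rule ccontr)
  assume no: "\<not> (\<exists>r\<in>R. Z \<subseteq> C r)"
  have "\<exists>f. f \<in> polyfun \<and> (\<exists>A\<in>Z. f A \<noteq> 0) \<and> (\<forall>B\<in>C r. f B = 0)" if "r \<in> R" for r
  proof -
    have "\<not> Z \<subseteq> C r" using no that by metis
    then obtain A where A: "A \<in> Z" "A \<notin> C r" by blast
    then have "A \<in> Rep N d"
      using zclosed_subset_Rep[OF zirred_zclosed[OF assms(1)]] by blast
    then show ?thesis using zclosed_nonmember[OF assms(3)[OF that] _ A(2)] A(1) by metis
  qed
  then obtain f where f: "\<And>r. r \<in> R \<Longrightarrow> f r \<in> polyfun \<and> (\<exists>A\<in>Z. f r A \<noteq> 0) \<and> (\<forall>B\<in>C r. f r B = 0)"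
    by metis
  have "\<exists>r\<in>R. \<forall>A\<in>Z. f r A = 0"
  proof (rule zirred_prime_prod[OF assms(1,2)])
    fix A assume "A \<in> Z"
    then obtain r where "r \<in> R" "A \<in> C r" using assms(4) by blast
    then show "(\<Prod>r\<in>R. f r A) = 0" using f assms(2) by (auto intro!: prod_zero)
  qed (use f in blast)
  then show False using f by blast
qed

text \<open>If neither closed piece contained the image, functions vanishing on the two pieces would
  restrict, on a line joining two parameter points, to nonzero univariate polynomials with zero
  product. \<open>L\<close> may be a proper affine subset because the chains built later freeze some
  parameters.\<close>

lemma zirred_zclosure_image:
  assumes poly: "\<And>k a c. (\<lambda>X. \<phi> X k a c) \<in> polyfun" and im: "\<phi> ` L \<subseteq> Rep N d"
    and "L \<noteq> {}" and aff: "\<And>X Y t. X \<in> L \<Longrightarrow> Y \<in> L \<Longrightarrow> line X (\<lambda>k a c. Y k a c - X k a c) t \<in> L"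
  shows "zirred N d (zclosure N d (\<phi> ` L))"
  unfolding zirred_def
proof (intro conjI allI impI)
  show "zclosed N d (zclosure N d (\<phi> ` L))" by (rule zclosed_zclosure)
  show "zclosure N d (\<phi> ` L) \<noteq> {}" using subset_zclosure[OF im] \<open>L \<noteq> {}\<close> by blast
  fix S T assume S: "zclosed N d S" and T: "zclosed N d T" and eq: "zclosure N d (\<phi> ` L) = S \<union> T"
  show "zclosure N d (\<phi> ` L) = S \<or> zclosure N d (\<phi> ` L) = T"
  proof (rule ccontr)
    assume "\<not> ?thesis"
    then have "\<not> \<phi> ` L \<subseteq> S" "\<not> \<phi> ` L \<subseteq> T"
      using zclosure_minimal S T eq by blast+
    then obtain X Y where X: "X \<in> L" "\<phi> X \<notin> S" and Y: "Y \<in> L" "\<phi> Y \<notin> T" by blast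
    obtain f where f: "f \<in> polyfun" "f (\<phi> X) \<noteq> 0" "\<And>B. B \<in> S \<Longrightarrow> f B = 0"
      using zclosed_nonmember[OF S _ X(2)] X(1) im by blast
    obtain g where g: "g \<in> polyfun" "g (\<phi> Y) \<noteq> 0" "\<And>B. B \<in> T \<Longrightarrow> g B = 0"
      using zclosed_nonmember[OF T _ Y(2)] Y(1) im by blast
    define l where "l = line X (\<lambda>k a c. Y k a c - X k a c)"
    have "(\<lambda>X. f (\<phi> X)) \<in> polyfun" "(\<lambda>X. g (\<phi> X)) \<in> polyfun"
      using polyfun_compose poly f(1) g(1) by blast+
    then obtain p q where p: "\<And>t. f (\<phi> (l t)) = poly p t" and q: "\<And>t. g (\<phi> (l t)) = poly q t"
      unfolding l_def by (meson polyfun_line)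
    have l01: "l 0 = X" "l 1 = Y" unfolding l_def line_def by auto
    have "p \<noteq> 0" "q \<noteq> 0" using p[of 0] q[of 1] l01 f(2) g(2) by auto
    moreover have "poly (p * q) t = 0" for t
    proof -
      have "l t \<in> L" unfolding l_def using aff X Y by blast
      then have "\<phi> (l t) \<in> S \<union> T" using eq subset_zclosure[OF im] by blast
      then show ?thesis using f g p[of t] q[of t] by auto
    qed
    ultimately show False using poly_all_0_iff_0[of "p * q"] by auto
  qed
qed

section \<open>Algebraic independence along chains of irreducible sets\<close>

fun gmon :: "(rep \<Rightarrow> complex) list \<Rightarrow> nat list \<Rightarrow> rep \<Rightarrow> complex" where
  "gmon (h # hs) (j # b) A = h A ^ j * gmon hs b A"
| "gmon _ _ A = 1"

text \<open>The exponents fill a box, each one bounded separately, so that their number is exactly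
  \<open>Suc m ^ n\<close>.\<close>

definition expos :: "nat \<Rightarrow> nat \<Rightarrow> nat list set" where
  "expos n m = {b. set b \<subseteq> {..m} \<and> length b = n}"

lemma finite_expos: "finite (expos n m)"
  unfolding expos_def by (rule finite_lists_length_eq) simp

lemma card_expos: "card (expos n m) = Suc m ^ n"
  unfolding expos_def by (subst card_lists_length_eq) auto

lemma expos_0: "expos 0 m = {[]}"
  unfolding expos_def by auto

lemma sum_expos_Suc:
  fixes f :: "nat list \<Rightarrow> 'a::comm_monoid_add"
  shows "(\<Sum>b\<in>expos (Suc n) m. f b) = (\<Sum>j\<le>m. \<Sum>b\<in>expos n m. f (j # b))"
proof -
  have "(\<Sum>b\<in>expos (Suc n) m. f b) = (\<Sum>(j, b)\<in>{..m} \<times> expos n m. f (j # b))"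
    by (rule sum.reindex_bij_witness[where i = "\<lambda>(j, b). j # b" and j = "\<lambda>b. (hd b, tl b)"])
      (auto simp: expos_def length_Suc_conv)
  then show ?thesis by (simp add: sum.cartesian_product)
qed

definition alg_indep :: "rep set \<Rightarrow> (rep \<Rightarrow> complex) list \<Rightarrow> bool" where
  "alg_indep Z hs \<longleftrightarrow> (\<forall>m c. (\<forall>A\<in>Z. (\<Sum>b\<in>expos (length hs) m. c b * gmon hs b A) = 0) \<longrightarrow>
     (\<forall>b\<in>expos (length hs) m. c b = 0))"

lemma polyfun_gmon: "set hs \<subseteq> polyfun \<Longrightarrow> gmon hs b \<in> polyfun"
proof (induction hs arbitrary: b)
  case Nil
  have "gmon [] b = (\<lambda>A. 1)" by auto
  then show ?case using polyfun.const by simp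
next
  case (Cons h hs)
  then have prems: "h \<in> polyfun" and IH: "gmon hs b \<in> polyfun" for b by auto
  show ?case
  proof (cases b)
    case Nil
    then have "gmon (h # hs) b = (\<lambda>A. 1)" by auto
    then show ?thesis using polyfun.const by simp
  next
    case (Cons j b')
    then have "gmon (h # hs) b = (\<lambda>A. h A ^ j * gmon hs b' A)" by auto
    then show ?thesis using prems IH by (auto intro: polyfun.mult polyfun_power)
  qed
qed

text \<open>Order a relation on \<open>Z\<close> by powers of \<open>f\<close>. The lowest power
  cancels, since \<open>f\<close> is not identically zero on the irreducible set \<open>Z\<close>;
  restricting to \<open>Y\<close>, where \<open>f\<close> vanishes, leaves a relation among
  \<open>hs\<close> alone.\<close>

lemma alg_indep_Cons:
  assumes Z: "zirred N d Z" and "Y \<subseteq> Z" and hs: "alg_indep Y hs" "set hs \<subseteq> polyfun"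
    and f: "f \<in> polyfun" "\<And>A. A \<in> Y \<Longrightarrow> f A = 0" "A \<in> Z" "f A \<noteq> 0"
  shows "alg_indep Z (f # hs)"
  unfolding alg_indep_def
proof (intro allI impI)
  fix m c assume 0: "\<forall>A\<in>Z. (\<Sum>b\<in>expos (length (f # hs)) m. c b * gmon (f # hs) b A) = 0"
  define n where "n = length hs"
  define G where "G j A = (\<Sum>b\<in>expos n m. c (j # b) * gmon hs b A)" for j A
  have G: "G j \<in> polyfun" for j
    unfolding G_def by (intro polyfun_sum polyfun.mult polyfun.const polyfun_gmon hs)
  have 0: "(\<Sum>j\<le>m. f A ^ j * G j A) = 0" if "A \<in> Z" for A
    using 0 that unfolding G_def n_def
    by (simp add: sum_expos_Suc sum_distrib_left mult_ac)
  have step: "\<forall>b\<in>expos n m. c (e # b) = 0" if "e \<le> m" for e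
    using that
  proof (induction e rule: less_induct)
    case (less e)
    \<comment> \<open>What remains of the relation after dividing by \<open>f ^ e\<close>, the
      coefficients below \<open>e\<close> being already zero on \<open>Z\<close>.\<close>
    define g where "g A = G e A + f A * (\<Sum>j\<in>{Suc e..m}. f A ^ (j - Suc e) * G j A)" for A
    have g: "g \<in> polyfun" unfolding g_def
      by (intro polyfun.add polyfun.mult polyfun_sum polyfun_power f G)
    have "f A ^ e * g A = 0" if "A \<in> Z" for A
    proof -
      have low: "G j A = 0" if "j < e" for j
        using less.IH[of j] less.prems that unfolding G_def by simp
      have "(\<Sum>j\<le>m. f A ^ j * G j A) = (\<Sum>j\<in>{e..m}. f A ^ j * G j A)"
        by (rule sum.mono_neutral_right) (auto simp: low)
      also have "\<dots> = f A ^ e * G e A + (\<Sum>j\<in>{Suc e..m}. f A ^ j * G j A)"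
        using less.prems by (simp add: sum.atLeast_Suc_atMost)
      also have "(\<Sum>j\<in>{Suc e..m}. f A ^ j * G j A)
          = f A ^ e * (f A * (\<Sum>j\<in>{Suc e..m}. f A ^ (j - Suc e) * G j A))"
      proof -
        have "f A ^ j = f A ^ e * (f A * f A ^ (j - Suc e))" if "Suc e \<le> j" for j
          using that by (simp flip: power_Suc power_add)
        then show ?thesis by (simp add: sum_distrib_left mult.assoc)
      qed
      finally show ?thesis using 0[OF that] unfolding g_def by (simp add: distrib_left)
    qed
    then have "(\<forall>A\<in>Z. f A ^ e = 0) \<or> (\<forall>A\<in>Z. g A = 0)"
      by (intro zirred_prime[OF Z] polyfun_power f g)
    then have "\<forall>A\<in>Z. g A = 0" using f(3,4) by auto
    then have "\<forall>A\<in>Y. G e A = 0" using \<open>Y \<subseteq> Z\<close> f(2) unfolding g_def by fastforce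
    then show ?case using hs(1)[unfolded alg_indep_def, THEN spec[of _ m], THEN spec[of _ "\<lambda>b. c (e # b)"]]
      unfolding G_def n_def by blast
  qed
  show "\<forall>b\<in>expos (length (f # hs)) m. c b = 0"
  proof
    fix b assume "b \<in> expos (length (f # hs)) m"
    then obtain j b' where "b = j # b'" "j \<le> m" "b' \<in> expos n m"
      unfolding expos_def n_def by (auto simp: length_Suc_conv)
    then show "c b = 0" using step by blast
  qed
qed

text \<open>Each strict inclusion supplies one function that vanishes on the smaller set but not on
  the larger.\<close>

lemma alg_indep_of_chain:
  assumes "\<And>i. i \<le> n \<Longrightarrow> zirred N d (Z i)" "\<And>i. i < n \<Longrightarrow> Z i \<subset> Z (Suc i)"
  shows "\<exists>hs. length hs = n \<and> set hs \<subseteq> polyfun \<and> alg_indep (Z n) hs"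
  using assms
proof (induction n)
  case 0
  then have "Z 0 \<noteq> {}" using zirred_nonempty by blast
  then show ?case unfolding alg_indep_def by (auto simp: expos_0)
next
  case (Suc n)
  then obtain hs where hs: "length hs = n" "set hs \<subseteq> polyfun" "alg_indep (Z n) hs" by force
  have sub: "Z n \<subset> Z (Suc n)" using Suc.prems by blast
  then obtain A where A: "A \<in> Z (Suc n)" "A \<notin> Z n" by blast
  have "zclosed N d (Z n)" "zclosed N d (Z (Suc n))"
    using Suc.prems(1) zirred_zclosed by auto
  then obtain f where "f \<in> polyfun" "f A \<noteq> 0" "\<And>B. B \<in> Z n \<Longrightarrow> f B = 0"
    using zclosed_nonmember[of N d "Z n" A] A zclosed_subset_Rep by blast
  then have "alg_indep (Z (Suc n)) (f # hs)"
    using alg_indep_Cons[OF Suc.prems(1)[of "Suc n"], of "Z n" hs f A] hs A sub by auto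
  then show ?case using hs \<open>f \<in> polyfun\<close> by (intro exI[of _ "f # hs"]) auto
qed

section \<open>Dimension of parametrised sets\<close>

text \<open>Gaussian elimination: the pivot \<open>u0\<close> is solved for in equation
  \<open>e\<close> and eliminated from the others. It yields both the relation between monomials
  below and all later comparisons of ranks.\<close>

lemma homogeneous_system_nontrivial:
  fixes M :: "'e \<Rightarrow> 'u \<Rightarrow> 'a::field"
  assumes "finite E" "finite U" "card E < card U"
  shows "\<exists>c. (\<exists>u\<in>U. c u \<noteq> 0) \<and> (\<forall>e\<in>E. (\<Sum>u\<in>U. M e u * c u) = 0)"
  using assms
proof (induction E arbitrary: U M)
  case empty
  then have "U \<noteq> {}" by auto
  then show ?case by (intro exI[of _ "\<lambda>_. 1"]) auto
next
  case (insert e E)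
  show ?case
  proof (cases "\<forall>u\<in>U. M e u = 0")
    case True
    obtain c where "\<exists>u\<in>U. c u \<noteq> 0" "\<forall>e\<in>E. (\<Sum>u\<in>U. M e u * c u) = 0"
      using insert.IH[of U M] insert.prems insert.hyps by fastforce
    then show ?thesis using True by (intro exI[of _ c]) auto
  next
    case False
    then obtain u0 where u0: "u0 \<in> U" "M e u0 \<noteq> 0" by blast
    define M' where "M' e' u = M e' u - M e' u0 * M e u / M e u0" for e' u
    have "card E < card (U - {u0})" using insert u0 by simp
    then obtain c where c: "\<exists>u\<in>U - {u0}. c u \<noteq> 0" "\<forall>e\<in>E. (\<Sum>u\<in>U - {u0}. M' e u * c u) = 0"
      using insert.IH[of "U - {u0}" M'] insert.prems by auto
    define s where "s = (\<Sum>u\<in>U - {u0}. M e u * c u)"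
    define c' where "c' = c(u0 := - s / M e u0)"
    have split: "(\<Sum>u\<in>U. M e' u * c' u) = (\<Sum>u\<in>U - {u0}. M e' u * c u) - M e' u0 * s / M e u0" for e'
      by (subst sum.remove[OF insert.prems(1) u0(1)]) (auto simp: c'_def intro!: sum.cong)
    have "(\<Sum>u\<in>U. M e' u * c' u) = 0" if "e' \<in> insert e E" for e'
    proof (cases "e' = e")
      case True
      then show ?thesis using u0(2) by (simp add: split s_def)
    next
      case False
      have "(\<Sum>u\<in>U - {u0}. M' e' u * c u)
          = (\<Sum>u\<in>U - {u0}. M e' u * c u) - (\<Sum>u\<in>U - {u0}. M e' u0 / M e u0 * (M e u * c u))"
        unfolding M'_def by (simp add: algebra_simps sum_subtractf)
      also have "\<dots> = (\<Sum>u\<in>U. M e' u * c' u)"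
        by (simp add: split s_def sum_distrib_left sum_divide_distrib)
      finally show ?thesis using c(2) that False by auto
    qed
    moreover have "\<exists>u\<in>U. c' u \<noteq> 0" using c(1) by (auto simp: c'_def)
    ultimately show ?thesis by blast
  qed
qed

definition coord_unit :: "nat \<Rightarrow> nat \<Rightarrow> nat \<Rightarrow> rep" where
  "coord_unit k a c = (\<lambda>k' a' c'. if k' = k \<and> a' = a \<and> c' = c then 1 else 0)"

text \<open>The coordinates in \<open>P\<close> are released one at a time: in each direction
  \<open>f\<close> has degree at most \<open>n\<close> but \<open>n + 1\<close> zeros. Coordinates
  outside \<open>P\<close> are arbitrary throughout.\<close>

lemma vanish_on_grid_imp_0:
  assumes "finite P" "line_degree_le f n"
    and "\<And>X. (\<forall>(k, a, c)\<in>P. X k a c \<in> of_nat ` {..n}) \<Longrightarrow> f X = 0"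
  shows "f X = 0"
  using assms(1,3)
proof (induction P arbitrary: X)
  case empty
  then show ?case by simp
next
  case (insert q P)
  obtain k a c where q: "q = (k, a, c)" by (cases q) auto
  show ?case
  proof (rule insert.IH)
    fix X :: rep assume X: "\<forall>(k, a, c)\<in>P. X k a c \<in> of_nat ` {..n}"
    \<comment> \<open>Setting the released coordinate to 0 makes the parameter of the line equal to
      that coordinate.\<close>
    define X0 where "X0 = line X (coord_unit k a c) (- X k a c)"
    obtain p where p: "degree p \<le> n" "\<And>t. f (line X0 (coord_unit k a c) t) = poly p t"
      using assms(2) unfolding line_degree_le_def by meson
    have "poly p (of_nat i) = 0" if "i \<le> n" for i
    proof -
      have "f (line X0 (coord_unit k a c) (of_nat i)) = 0"
      proof (rule insert.prems)
        show "\<forall>(k', a', c')\<in>insert q P.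
            line X0 (coord_unit k a c) (of_nat i) k' a' c' \<in> of_nat ` {..n}"
          using X that insert.hyps(2) unfolding q X0_def line_def coord_unit_def by auto
      qed
      then show ?thesis using p by simp
    qed
    then have sub: "of_nat ` {..n} \<subseteq> {t. poly p t = 0}" by auto
    have "p = 0"
    proof (rule ccontr)
      assume "p \<noteq> 0"
      then have "card (of_nat ` {..n} :: complex set) \<le> card {t. poly p t = 0}"
        using sub poly_roots_finite by (intro card_mono) auto
      also have "\<dots> \<le> n" using card_poly_roots_bound[OF \<open>p \<noteq> 0\<close>] p(1) by simp
      finally show False by (simp add: card_image inj_on_def)
    qed
    moreover have "line X0 (coord_unit k a c) (X k a c) = X"
      unfolding X0_def line_def by (auto simp: fun_eq_iff)
    ultimately show "f X = 0" using p(2)[of "X k a c"] by simp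
  qed
qed

lemma line_degree_le_gmon:
  assumes "\<And>h. h \<in> set hs \<Longrightarrow> line_degree_le h n" "b \<in> expos (length hs) m"
  shows "line_degree_le (gmon hs b) (length hs * (m * n))"
  using assms
proof (induction hs arbitrary: b)
  case Nil
  have "gmon [] b = (\<lambda>A. 1)" by auto
  then show ?case using line_degree_le_const by simp
next
  case (Cons h hs)
  then obtain j b' where b: "b = j # b'" "j \<le> m" "b' \<in> expos (length hs) m"
    unfolding expos_def by (auto simp: length_Suc_conv)
  have "line_degree_le (\<lambda>A. h A ^ j * gmon hs b' A) (j * n + length hs * (m * n))"
    using Cons b by (intro line_degree_le_mult line_degree_le_power) auto
  moreover have "gmon (h # hs) b = (\<lambda>A. h A ^ j * gmon hs b' A)" using b by auto
  ultimately show ?case using b(2) by (auto elim!: line_degree_le_mono)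
qed

lemma common_line_degree:
  assumes "set hs \<subseteq> polyfun"
  shows "\<exists>n. \<forall>h\<in>set hs. line_degree_le h n"
  using assms
proof (induction hs)
  case (Cons h hs)
  then obtain n where "\<forall>h\<in>set hs. line_degree_le h n" by auto
  moreover obtain m where "line_degree_le h m" using polyfun_line_degree_le[of h] Cons.prems by auto
  ultimately show ?case by (intro exI[of _ "max m n"]) (auto elim!: line_degree_le_mono)
qed auto

lemma gmon_compose: "gmon hs b (\<phi> X) = gmon (map (\<lambda>h X. h (\<phi> X)) hs) b X"
proof (induction hs arbitrary: b)
  case (Cons h hs)
  then show ?case by (cases b) auto
qed auto

text \<open>Counting: the (m+1)^n monomials of degree at most m in n polynomial functions are determined by
  their values on a grid with O(m^D) points, D being the number of parameters.\<close>

lemma alg_indep_length_le: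
  assumes poly: "\<And>k a c. (\<lambda>X. \<phi> X k a c) \<in> polyfun" and "finite P"
    and dep: "\<And>X Y. (\<And>k a c. (k, a, c) \<in> P \<Longrightarrow> X k a c = Y k a c) \<Longrightarrow> \<phi> X = \<phi> Y"
    and hs: "alg_indep Z hs" "set hs \<subseteq> polyfun" and Z: "Z \<subseteq> zclosure N d (range \<phi>)"
  shows "length hs \<le> card P"
proof (rule ccontr)
  assume long: "\<not> length hs \<le> card P"
  define D where "D = card P"
  define n where "n = length hs"
  define gs where "gs = map (\<lambda>h X. h (\<phi> X)) hs"
  have n: "Suc D \<le> n" using long unfolding n_def D_def by simp
  have "set gs \<subseteq> polyfun" unfolding gs_def using hs(2) polyfun_compose poly by (auto 0 3)
  then obtain \<delta> where \<delta>: "\<forall>g\<in>set gs. line_degree_le g \<delta>" using common_line_degree by blast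
  \<comment> \<open>Chosen so that the grid has fewer points than there are monomials:
    \<open>Suc K\<close> is at most \<open>(n * \<delta> + 1) * Suc m\<close>, so its
    \<open>D\<close>-th power is at most \<open>m * Suc m ^ D\<close>, which is less than
    \<open>Suc m ^ Suc D\<close>.\<close>
  define m where "m = (n * \<delta> + 1) ^ D"
  define K where "K = n * (m * \<delta>)"
  define pt :: "(nat \<times> nat \<times> nat \<Rightarrow> nat) \<Rightarrow> rep"
    where "pt q = (\<lambda>k a c. if (k, a, c) \<in> P then of_nat (q (k, a, c)) else 0)" for q
  define E where "E = PiE P (\<lambda>_. {..K})"
  have "finite E" unfolding E_def using \<open>finite P\<close> by (intro finite_PiE) auto
  have "card E = Suc K ^ D" unfolding E_def D_def using \<open>finite P\<close> by (simp add: card_PiE)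
  also have "\<dots> \<le> ((n * \<delta> + 1) * Suc m) ^ D"
    by (rule power_mono) (auto simp: K_def algebra_simps)
  also have "\<dots> = m * Suc m ^ D" by (simp only: power_mult_distrib m_def[symmetric])
  also have "\<dots> < Suc m ^ Suc D" by simp
  also have "\<dots> \<le> Suc m ^ n" using n by (intro power_increasing) auto
  finally have "card E < card (expos n m)" by (simp add: card_expos)
  then obtain c where c: "\<exists>b\<in>expos n m. c b \<noteq> 0"
      "\<forall>q\<in>E. (\<Sum>b\<in>expos n m. gmon gs b (pt q) * c b) = 0"
    using homogeneous_system_nontrivial[OF \<open>finite E\<close> finite_expos, of n m "\<lambda>q b. gmon gs b (pt q)"]
    by blast
  define F where "F A = (\<Sum>b\<in>expos n m. c b * gmon hs b A)" for A
  have F: "F \<in> polyfun" unfolding F_def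
    by (intro polyfun_sum polyfun.mult polyfun.const polyfun_gmon hs)
  have F\<phi>: "F (\<phi> X) = (\<Sum>b\<in>expos n m. c b * gmon gs b X)" for X
    unfolding F_def gs_def by (simp add: gmon_compose)
  have "F (\<phi> X) = 0" for X
  proof (rule vanish_on_grid_imp_0[where f = "\<lambda>X. F (\<phi> X)", OF \<open>finite P\<close>])
    have "line_degree_le (\<lambda>X. \<Sum>b\<in>expos n m. c b * gmon gs b X) (0 + K)"
      unfolding K_def n_def
      by (intro line_degree_le_sum line_degree_le_mult line_degree_le_const)
        (use line_degree_le_gmon[of gs \<delta>] \<delta> in \<open>auto simp: gs_def\<close>)
    then show "line_degree_le (\<lambda>X. F (\<phi> X)) K" by (simp add: F\<phi>)
  next
    fix X :: rep assume X: "\<forall>(k, a, c)\<in>P. X k a c \<in> of_nat ` {..K}"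
    then have "\<forall>p\<in>P. \<exists>i\<le>K. X (fst p) (fst (snd p)) (snd (snd p)) = of_nat i" by fastforce
    then obtain q where q: "\<And>p. p \<in> P \<Longrightarrow> q p \<le> K \<and> X (fst p) (fst (snd p)) (snd (snd p)) = of_nat (q p)"
      by metis
    have "restrict q P \<in> E" unfolding E_def using q by auto
    then have "F (\<phi> (pt (restrict q P))) = 0" using c(2) by (simp add: F\<phi> mult.commute)
    moreover have "\<phi> (pt (restrict q P)) = \<phi> X"
      by (rule dep) (use q in \<open>force simp: pt_def\<close>)
    ultimately show "F (\<phi> X) = 0" by simp
  qed
  then have "\<forall>A\<in>Z. F A = 0" using Z F unfolding zclosure_def by auto
  then show False using hs(1) c(1) unfolding alg_indep_def F_def n_def by blast
qed

section \<open>Krull dimension through chains\<close>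

definition zchain :: "nat \<Rightarrow> (nat \<Rightarrow> nat) \<Rightarrow> rep set \<Rightarrow> nat \<Rightarrow> bool" where
  "zchain N d X n \<longleftrightarrow> (\<exists>Z :: nat \<Rightarrow> rep set. (\<forall>i\<le>n. zirred N d (Z i)) \<and>
      (\<forall>i<n. Z i \<subset> Z (Suc i)) \<and> Z n \<subseteq> X)"

text \<open>A supremum of naturals is informative only for bounded sets; here the maximum is
  required to be attained.\<close>

definition has_zdim :: "nat \<Rightarrow> (nat \<Rightarrow> nat) \<Rightarrow> rep set \<Rightarrow> nat \<Rightarrow> bool" where
  "has_zdim N d X D \<longleftrightarrow> zchain N d X D \<and> (\<forall>n. zchain N d X n \<longrightarrow> n \<le> D)"

lemma has_zdim_zdim: "has_zdim N d X D \<Longrightarrow> zdim N d X = D"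
  unfolding zdim_def has_zdim_def zchain_def by (intro cSup_eq_maximum) auto

lemma zchain_le_card_params:
  assumes "\<And>k a c. (\<lambda>X. \<phi> X k a c) \<in> polyfun" "finite P"
    and "\<And>X Y. (\<And>k a c. (k, a, c) \<in> P \<Longrightarrow> X k a c = Y k a c) \<Longrightarrow> \<phi> X = \<phi> Y"
    and "zchain N d (zclosure N d (range \<phi>)) n"
  shows "n \<le> card P"
proof -
  obtain Z where Z: "\<And>i. i \<le> n \<Longrightarrow> zirred N d (Z i)" "\<And>i. i < n \<Longrightarrow> Z i \<subset> Z (Suc i)"
      "Z n \<subseteq> zclosure N d (range \<phi>)"
    using assms(4) unfolding zchain_def by blast
  then obtain hs where "length hs = n" "set hs \<subseteq> polyfun" "alg_indep (Z n) hs"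
    using alg_indep_of_chain[of n N d Z] by blast
  then show ?thesis using alg_indep_length_le[OF assms(1-3) _ _ Z(3), of hs] by blast
qed

text \<open>The lower bound switches the parameters on one at a time, in the order of \<open>cls\<close>: while all
  parameters of a higher class rest at the base point, a parameter is itself a coordinate of
  \<open>\<phi> X\<close>, so each switch enlarges the closure of the image.\<close>

lemma zchain_card_params:
  fixes cls :: "nat \<times> nat \<times> nat \<Rightarrow> nat"
  assumes poly: "\<And>k a c. (\<lambda>X. \<phi> X k a c) \<in> polyfun" and "finite P"
    and im: "range \<phi> \<subseteq> Rep N d"
    and tri: "\<And>X k a c. (k, a, c) \<in> P \<Longrightarrow>
      (\<And>k' a' c'. (k', a', c') \<in> P \<Longrightarrow> cls (k', a', c') > cls (k, a, c) \<Longrightarrow> X k' a' c' = X0 k' a' c') \<Longrightarrow>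
      \<phi> X k a c = X k a c"
  shows "zchain N d (zclosure N d (range \<phi>)) (card P)"
proof -
  obtain ps0 where ps0: "set ps0 = P" "distinct ps0" using finite_distinct_list[OF \<open>finite P\<close>] by blast
  define ps where "ps = sort_key cls ps0"
  have ps: "set ps = P" "distinct ps" "length ps = card P" "sorted (map cls ps)"
    unfolding ps_def using ps0 distinct_card[of ps0] by auto
  define L where "L t = {X :: rep. \<forall>k a c. (k, a, c) \<in> set (drop t ps) \<longrightarrow> X k a c = X0 k a c}" for t
  define Z where "Z t = zclosure N d (\<phi> ` L t)" for t
  have X0: "X0 \<in> L t" for t unfolding L_def by auto
  have Lmono: "L t \<subseteq> L (Suc t)" for t
    unfolding L_def using set_drop_subset_set_drop[of t "Suc t" ps] by auto
  have sub: "\<phi> ` L t \<subseteq> Z t" for t unfolding Z_def using subset_zclosure im by (metis image_subset_iff range_subsetD)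
  have irr: "zirred N d (Z t)" for t
    unfolding Z_def
  proof (rule zirred_zclosure_image[OF poly])
    show "\<phi> ` L t \<subseteq> Rep N d" using im by auto
    show "L t \<noteq> {}" using X0 by blast
  qed (auto simp: L_def line_def)
  have "Z t \<subset> Z (Suc t)" if t: "t < card P" for t
  proof -
    have mono: "Z t \<subseteq> Z (Suc t)"
      using zclosure_minimal[OF zclosed_zclosure, of "\<phi> ` L t" N d "\<phi> ` L (Suc t)"] sub[of "Suc t"] Lmono[of t]
      unfolding Z_def by blast
    obtain k a c where p: "ps ! t = (k, a, c)" by (cases "ps ! t") auto
    then have pP: "(k, a, c) \<in> P" using ps t by (metis nth_mem)
    have drop: "drop t ps = (k, a, c) # drop (Suc t) ps"
      using Cons_nth_drop_Suc[of t ps] t ps(3) p by simp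
    have coord: "\<phi> X k a c = X k a c" if X: "X \<in> L (Suc t)" for X
    proof (rule tri[OF pP])
      fix k' a' c' assume q: "(k', a', c') \<in> P" "cls (k', a', c') > cls (k, a, c)"
      then obtain s where s: "s < length ps" "ps ! s = (k', a', c')" using ps(1) by (metis in_set_conv_nth)
      have "t < s"
      proof (rule ccontr)
        assume "\<not> t < s"
        then have "cls (ps ! s) \<le> cls (ps ! t)"
          using sorted_nth_mono[OF ps(4), of s t] t ps(3) by simp
        then show False using q(2) s(2) p by simp
      qed
      then have "(k', a', c') \<in> set (drop (Suc t) ps)"
        using s by (auto simp: set_conv_nth intro!: exI[of _ "s - Suc t"])
      then show "X k' a' c' = X0 k' a' c'" using X unfolding L_def by blast
    qed
    define f where "f A = A k a c - X0 k a c" for A :: rep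
    have "f \<in> polyfun" unfolding f_def by (intro polyfun_diff polyfun.coord polyfun.const)
    moreover have "f B = 0" if B: "B \<in> \<phi> ` L t" for B
    proof -
      obtain X where X: "X \<in> L t" "B = \<phi> X" using B by blast
      then have "X k a c = X0 k a c" unfolding L_def drop by simp
      then show ?thesis using coord[of X] X Lmono[of t] unfolding f_def by auto
    qed
    ultimately have "\<forall>A\<in>Z t. f A = 0" unfolding Z_def zclosure_def by blast
    moreover
    define X where "X = line X0 (coord_unit k a c) 1"
    have "(k, a, c) \<notin> set (drop (Suc t) ps)"
      using ps(2) distinct_drop[of ps t] unfolding drop by simp
    then have X: "X \<in> L (Suc t)" unfolding L_def X_def line_def coord_unit_def by auto
    then have "f (\<phi> X) \<noteq> 0"
      using coord[OF X] unfolding f_def by (simp add: X_def line_def coord_unit_def)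
    moreover have "\<phi> X \<in> Z (Suc t)" using sub[of "Suc t"] X by blast
    ultimately show ?thesis using mono by blast
  qed
  moreover have "Z (card P) \<subseteq> zclosure N d (range \<phi>)"
    unfolding Z_def zclosure_def by blast
  ultimately show ?thesis unfolding zchain_def using irr by blast
qed

lemma zirred_zclosure_range:
  assumes "\<And>k a c. (\<lambda>X. \<phi> X k a c) \<in> polyfun" "range \<phi> \<subseteq> Rep N d"
  shows "zirred N d (zclosure N d (range \<phi>))"
  using zirred_zclosure_image[OF assms] by simp

lemma has_zdim_zclosure_range:
  fixes cls :: "nat \<times> nat \<times> nat \<Rightarrow> nat"
  assumes "\<And>k a c. (\<lambda>X. \<phi> X k a c) \<in> polyfun" "finite P" "range \<phi> \<subseteq> Rep N d"
    and "\<And>X Y. (\<And>k a c. (k, a, c) \<in> P \<Longrightarrow> X k a c = Y k a c) \<Longrightarrow> \<phi> X = \<phi> Y"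
    and "\<And>X k a c. (k, a, c) \<in> P \<Longrightarrow>
      (\<And>k' a' c'. (k', a', c') \<in> P \<Longrightarrow> cls (k', a', c') > cls (k, a, c) \<Longrightarrow> X k' a' c' = X0 k' a' c') \<Longrightarrow>
      \<phi> X k a c = X k a c"
  shows "has_zdim N d (zclosure N d (range \<phi>)) (card P)"
  unfolding has_zdim_def
proof (intro conjI allI impI)
  show "zchain N d (zclosure N d (range \<phi>)) (card P)"
    by (rule zchain_card_params[OF assms(1-3), of cls X0]) (use assms(5) in blast)+
  show "n \<le> card P" if "zchain N d (zclosure N d (range \<phi>)) n" for n
    using zchain_le_card_params[OF assms(1,2,4) that] .
qed

section \<open>Dimension of the ambient matrix space\<close>

definition Rep_coords :: "nat \<Rightarrow> (nat \<Rightarrow> nat) \<Rightarrow> (nat \<times> nat \<times> nat) set" where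
  "Rep_coords N d = {(k, a, c). 1 \<le> k \<and> k \<le> N \<and> a < d k \<and> c < d (k - 1)}"

lemma Rep_coords_eq: "Rep_coords N d = (SIGMA k:{1..N}. {..<d k} \<times> {..<d (k - 1)})"
  unfolding Rep_coords_def by auto

lemma finite_Rep_coords: "finite (Rep_coords N d)"
  unfolding Rep_coords_eq by auto

lemma has_zdim_Rep: "has_zdim N d (Rep N d) (card (Rep_coords N d))"
proof -
  define \<phi> :: "rep \<Rightarrow> rep" where "\<phi> X k a c = (if (k, a, c) \<in> Rep_coords N d then X k a c else 0)" for X k a c
  have im: "range \<phi> \<subseteq> Rep N d" unfolding \<phi>_def Rep_def Rep_coords_def by auto
  have "\<phi> A = A" if "A \<in> Rep N d" for A
    using that unfolding \<phi>_def Rep_def Rep_coords_def by (auto simp: fun_eq_iff)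
  then have "Rep N d \<subseteq> range \<phi>" by (metis range_eqI subsetI)
  then have "zclosure N d (range \<phi>) = Rep N d"
    using subset_zclosure[OF im] unfolding zclosure_def by blast
  moreover have "has_zdim N d (zclosure N d (range \<phi>)) (card (Rep_coords N d))"
  \<comment> \<open>Each parameter is unconditionally a coordinate of the image, so one class and an
    arbitrary base point suffice.\<close>
  proof (rule has_zdim_zclosure_range[where cls = "\<lambda>_. 0" and ?X0.0 = undefined])
    show "(\<lambda>X. \<phi> X k a c) \<in> polyfun" for k a c
      unfolding \<phi>_def by (cases "(k, a, c) \<in> Rep_coords N d") (auto intro: polyfun.intros)
  qed (auto simp: \<phi>_def finite_Rep_coords fun_eq_iff im)
  ultimately show ?thesis by simp
qed

section \<open>Strata of the zero locus of the product\<close>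

text \<open>Values beyond \<open>N\<close> are pinned to 0 so that these functions form a finite set
  and can be counted.\<close>

definition rank_seqs :: "nat \<Rightarrow> (nat \<Rightarrow> nat) \<Rightarrow> (nat \<Rightarrow> nat) set" where
  "rank_seqs N d = {r. r 0 = d 0 \<and> r N = 0 \<and> (\<forall>k<N. r (Suc k) \<le> r k \<and> r (Suc k) \<le> d (Suc k)) \<and>
     (\<forall>k>N. r k = 0)}"

text \<open>The final rank stays free so that paths can be prolonged step by step in the probability
  computation.\<close>

definition rank_paths :: "nat \<Rightarrow> (nat \<Rightarrow> nat) \<Rightarrow> nat \<Rightarrow> (nat \<Rightarrow> nat) set" where
  "rank_paths k d s = {r. r 0 = d 0 \<and> r k = s \<and> (\<forall>i<k. r (Suc i) \<le> r i \<and> r (Suc i) \<le> d (Suc i)) \<and>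
     (\<forall>i>k. r i = 0)}"

lemma rank_seqs_eq_rank_paths: "rank_seqs N d = rank_paths N d 0"
  unfolding rank_seqs_def rank_paths_def by auto

lemma rank_paths_le: "r \<in> rank_paths k d s \<Longrightarrow> i \<le> k \<Longrightarrow> r i \<le> d 0"
proof (induction i)
  case (Suc i)
  then have "r (Suc i) \<le> r i" unfolding rank_paths_def by auto
  then show ?case using Suc by simp
qed (auto simp: rank_paths_def)

lemma finite_rank_paths: "finite (rank_paths k d s)"
proof (rule finite_subset)
  show "finite {f. \<forall>x. (x \<in> {..k} \<longrightarrow> f x \<in> {..d 0}) \<and> (x \<notin> {..k} \<longrightarrow> f x = 0)}"
    by (rule finite_set_of_finite_funs) auto
  show "rank_paths k d s \<subseteq> {f. \<forall>x. (x \<in> {..k} \<longrightarrow> f x \<in> {..d 0}) \<and> (x \<notin> {..k} \<longrightarrow> f x = 0)}"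
  proof clarify
    fix r x assume "r \<in> rank_paths k d s"
    then show "(x \<in> {..k} \<longrightarrow> r x \<in> {..d 0}) \<and> (x \<notin> {..k} \<longrightarrow> r x = 0)"
      using rank_paths_le[of r k d s x] unfolding rank_paths_def by auto
  qed
qed

text \<open>Each summand is the codimension of the matrices of rank \<open>r k\<close> among those
  with \<open>d k\<close> rows and \<open>r (k - 1)\<close> columns.\<close>

definition stratum_codim :: "nat \<Rightarrow> (nat \<Rightarrow> nat) \<Rightarrow> (nat \<Rightarrow> nat) \<Rightarrow> nat" where
  "stratum_codim N d r = (\<Sum>k=1..N. (d k - r k) * (r (k - 1) - r k))"

text \<open>In block form \<open>A\<^sub>k = [[I; Z\<^sub>k] W\<^sub>k - U\<^sub>k Z\<^sub>k\<^sub>-\<^sub>1 | U\<^sub>k]\<close>, where \<open>[I; Z\<^sub>k]\<close> is a basis matrix of the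
  image of \<open>A\<^sub>k \<cdots> A\<^sub>1\<close>. The blocks \<open>W\<^sub>k\<close> (rows below \<open>r k\<close>), \<open>Z\<^sub>k\<close> (columns below \<open>r k\<close>) and \<open>U\<^sub>k\<close>
  (columns from \<open>r (k - 1)\<close> on) are stored at disjoint positions of the matrix \<open>X k\<close>, leaving out
  exactly the rectangle counted by the codimension.\<close>

definition stratum_param :: "nat \<Rightarrow> (nat \<Rightarrow> nat) \<Rightarrow> (nat \<Rightarrow> nat) \<Rightarrow> rep \<Rightarrow> rep" where
  "stratum_param N d r X k a c = (if (k, a, c) \<in> Rep_coords N d then
     (if r (k - 1) \<le> c then X k a c
      else (if a < r k then X k a c else \<Sum>b<r k. X k a b * X k b c)
        - (\<Sum>u\<in>{r (k - 1)..<d (k - 1)}. X k a u * X (k - 1) u c))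
     else 0)"

definition image_basis :: "(nat \<Rightarrow> nat) \<Rightarrow> rep \<Rightarrow> rep" where
  "image_basis r X k u b = (if k = 0 \<or> u < r k then (if u = b then 1 else 0) else X k u b)"

definition stratum_coords :: "nat \<Rightarrow> (nat \<Rightarrow> nat) \<Rightarrow> (nat \<Rightarrow> nat) \<Rightarrow> (nat \<times> nat \<times> nat) set" where
  "stratum_coords N d r =
     {(k, a, c) \<in> Rep_coords N d. \<not> (r k \<le> a \<and> r k \<le> c \<and> c < r (k - 1))}"

definition stratum_closure :: "nat \<Rightarrow> (nat \<Rightarrow> nat) \<Rightarrow> (nat \<Rightarrow> nat) \<Rightarrow> rep set" where
  "stratum_closure N d r = zclosure N d (range (stratum_param N d r))"

lemma rank_seqs_le: "r \<in> rank_seqs N d \<Longrightarrow> k \<le> N \<Longrightarrow> r k \<le> d k"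
  unfolding rank_seqs_def by (cases k) auto

lemma rank_seqs_Suc_le: "r \<in> rank_seqs N d \<Longrightarrow> k < N \<Longrightarrow> r (Suc k) \<le> r k"
  unfolding rank_seqs_def by auto

lemma rank_seqs_0: "r \<in> rank_seqs N d \<Longrightarrow> r 0 = d 0"
  unfolding rank_seqs_def by auto

lemma rank_seqs_le_first: "r \<in> rank_seqs N d \<Longrightarrow> k \<le> N \<Longrightarrow> r k \<le> d 0"
  unfolding rank_seqs_eq_rank_paths by (rule rank_paths_le)

lemma finite_rank_seqs: "finite (rank_seqs N d)"
  unfolding rank_seqs_eq_rank_paths by (rule finite_rank_paths)

lemma sum_lessThan_split:
  fixes f :: "nat \<Rightarrow> 'a::comm_monoid_add"
  assumes "m \<le> n"
  shows "(\<Sum>v<n. f v) = (\<Sum>v<m. f v) + (\<Sum>v\<in>{m..<n}. f v)"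
  using assms sum.atLeastLessThan_concat[of 0 m n f] by (simp add: lessThan_atLeast0)

lemma polyfun_stratum_param: "(\<lambda>X. stratum_param N d r X k a c) \<in> polyfun"
  unfolding stratum_param_def
  by (cases "(k, a, c) \<in> Rep_coords N d"; cases "r (k - 1) \<le> c"; cases "a < r k")
    (auto intro!: polyfun.const polyfun.coord polyfun_diff polyfun_sum polyfun.mult)

lemma stratum_param_in_Rep: "stratum_param N d r X \<in> Rep N d"
  unfolding stratum_param_def Rep_def Rep_coords_def by auto

text \<open>The term subtracted in the left block of the parametrised matrix cancels what the right
  block contributes on the lower rows of the previous basis, leaving the next basis times the block
  W.\<close>

lemma stratum_param_image_basis:
  assumes r: "r \<in> rank_seqs N d" and "k < N" "a < d (Suc k)" "c < r k"
  shows "(\<Sum>v<d k. stratum_param N d r X (Suc k) a v * image_basis r X k v c)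
       = (\<Sum>b<r (Suc k). image_basis r X (Suc k) a b * X (Suc k) b c)"
proof -
  have le: "r k \<le> d k" using rank_seqs_le[OF r] \<open>k < N\<close> by simp
  have "(\<Sum>v<r k. stratum_param N d r X (Suc k) a v * image_basis r X k v c)
      = (\<Sum>v<r k. if v = c then stratum_param N d r X (Suc k) a c else 0)"
    by (rule sum.cong) (auto simp: image_basis_def)
  moreover have "(\<Sum>v\<in>{r k..<d k}. stratum_param N d r X (Suc k) a v * image_basis r X k v c)
      = (\<Sum>u\<in>{r k..<d k}. X (Suc k) a u * X k u c)"
    using assms rank_seqs_0[OF r]
    by (intro sum.cong) (auto simp: image_basis_def stratum_param_def Rep_coords_def)
  ultimately have "(\<Sum>v<d k. stratum_param N d r X (Suc k) a v * image_basis r X k v c)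
      = (if a < r (Suc k) then X (Suc k) a c else \<Sum>b<r (Suc k). X (Suc k) a b * X (Suc k) b c)"
    using assms le by (simp add: sum_lessThan_split[OF le] stratum_param_def Rep_coords_def)
  also have "\<dots> = (\<Sum>b<r (Suc k). image_basis r X (Suc k) a b * X (Suc k) b c)"
  proof (cases "a < r (Suc k)")
    case True
    have "(\<Sum>b<r (Suc k). image_basis r X (Suc k) a b * X (Suc k) b c)
       = (\<Sum>b<r (Suc k). if b = a then X (Suc k) a c else 0)"
      using True by (intro sum.cong) (auto simp: image_basis_def)
    then show ?thesis using True by simp
  qed (simp add: image_basis_def)
  finally show ?thesis .
qed

text \<open>A rank bound in the form of a factorisation through \<open>r k\<close> columns. For
  \<open>k = N\<close> the sum is empty, so the product vanishes.\<close>

lemma prodmat_stratum_param: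
  assumes r: "r \<in> rank_seqs N d" and "k \<le> N"
  shows "\<exists>Q. \<forall>a<d k. \<forall>c<d 0. prodmat d (stratum_param N d r X) k a c
    = (\<Sum>b<r k. image_basis r X k a b * Q b c)"
  using \<open>k \<le> N\<close>
proof (induction k)
  case 0
  have "(\<Sum>b<r 0. image_basis r X 0 a b * (if b = c then 1 else 0)) = (if a = c then 1 else 0)"
    if "a < d 0" for a c
  proof -
    have "(\<Sum>b<r 0. image_basis r X 0 a b * (if b = c then 1 else 0))
       = (\<Sum>b<r 0. if b = a then (if a = c then 1 else 0) else 0)"
      by (rule sum.cong) (auto simp: image_basis_def)
    then show ?thesis using that rank_seqs_0[OF r] by simp
  qed
  then show ?case by (intro exI[of _ "\<lambda>b c. if b = c then 1 else 0"]) auto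
next
  case (Suc k)
  then obtain Q where Q: "\<And>a c. a < d k \<Longrightarrow> c < d 0 \<Longrightarrow> prodmat d (stratum_param N d r X) k a c
      = (\<Sum>b<r k. image_basis r X k a b * Q b c)" by fastforce
  let ?A = "stratum_param N d r X (Suc k)"
  show ?case
  proof (intro exI[of _ "\<lambda>b' c. \<Sum>b<r k. X (Suc k) b' b * Q b c"] allI impI)
    fix a c assume a: "a < d (Suc k)" and c: "c < d 0"
    have "prodmat d (stratum_param N d r X) (Suc k) a c
        = (\<Sum>m<d k. ?A a m * (\<Sum>b<r k. image_basis r X k m b * Q b c))"
      using Q c by simp
    also have "\<dots> = (\<Sum>b<r k. (\<Sum>m<d k. ?A a m * image_basis r X k m b) * Q b c)"
      by (simp add: sum_distrib_left sum_distrib_right mult.assoc sum.swap[of _ "{..<d k}"])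
    also have "\<dots> = (\<Sum>b<r k. (\<Sum>b'<r (Suc k). image_basis r X (Suc k) a b' * X (Suc k) b' b) * Q b c)"
      using stratum_param_image_basis[OF r _ a] Suc.prems by (intro sum.cong) auto
    also have "\<dots> = (\<Sum>b'<r (Suc k). image_basis r X (Suc k) a b' * (\<Sum>b<r k. X (Suc k) b' b * Q b c))"
      by (simp add: sum_distrib_left sum_distrib_right mult.assoc sum.swap[of _ "{..<r k}"])
    finally show "prodmat d (stratum_param N d r X) (Suc k) a c
      = (\<Sum>b'<r (Suc k). image_basis r X (Suc k) a b' * (\<Sum>b<r k. X (Suc k) b' b * Q b c))" .
  qed
qed

lemma polyfun_prodmat: "(\<lambda>A. prodmat d A k r c) \<in> polyfun"
  by (induction k arbitrary: r c) (auto intro!: polyfun.intros polyfun_sum)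

lemma zclosed_Sigma0: "zclosed N d (Sigma0 N d)"
  unfolding zclosed_def Sigma0_def
  by (intro exI[of _ "{(\<lambda>A. prodmat d A N r c) | r c. r < d N \<and> c < d 0}"])
    (auto intro: polyfun_prodmat)

lemma stratum_closure_subset_Sigma0:
  assumes r: "r \<in> rank_seqs N d"
  shows "stratum_closure N d r \<subseteq> Sigma0 N d"
  unfolding stratum_closure_def
proof (rule zclosure_minimal[OF zclosed_Sigma0], clarify)
  fix X
  have "r N = 0" using r unfolding rank_seqs_def by simp
  then show "stratum_param N d r X \<in> Sigma0 N d"
    using prodmat_stratum_param[OF r order.refl, of X] stratum_param_in_Rep
    unfolding Sigma0_def by auto
qed

lemma zirred_stratum_closure: "zirred N d (stratum_closure N d r)"
  unfolding stratum_closure_def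
  using stratum_param_in_Rep by (intro zirred_zclosure_range polyfun_stratum_param) auto

lemma finite_stratum_coords: "finite (stratum_coords N d r)"
  unfolding stratum_coords_def by (rule finite_subset[OF _ finite_Rep_coords]) auto

lemma card_stratum_coords:
  assumes r: "r \<in> rank_seqs N d"
  shows "card (Rep_coords N d) = card (stratum_coords N d r) + stratum_codim N d r"
proof -
  have le: "c < d (k - 1)" if "1 \<le> k" "k \<le> N" "c < r (k - 1)" for k c
    using rank_seqs_le[OF r, of "k - 1"] that by linarith
  define Q where "Q = (SIGMA k:{1..N}. {r k..<d k} \<times> {r k..<r (k - 1)})"
  have "Rep_coords N d = stratum_coords N d r \<union> Q" "stratum_coords N d r \<inter> Q = {}"
    unfolding Q_def stratum_coords_def Rep_coords_def using le by auto
  moreover have "finite Q" unfolding Q_def by auto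
  moreover have "card Q = stratum_codim N d r"
    unfolding Q_def stratum_codim_def by (subst card_SigmaI) auto
  ultimately show ?thesis using card_Un_disjoint[OF finite_stratum_coords] by metis
qed

text \<open>Here the blocks U and Z are zero and W is a truncated identity. The point serves as
  origin of the triangular chain and as a witness that the rank \<open>r k\<close> is
  attained.\<close>

definition stratum_base :: "(nat \<Rightarrow> nat) \<Rightarrow> rep" where
  "stratum_base r k a c = (if a = c \<and> a < r k then 1 else 0)"

text \<open>Triangularity: entries of U (class 2) are always matrix entries; entries of W (class 1)
  are so once U is zero; entries of Z (class 0) are so once, in addition, W is the truncated
  identity.\<close>

lemma has_zdim_stratum_closure:
  assumes r: "r \<in> rank_seqs N d"
  shows "has_zdim N d (stratum_closure N d r) (card (stratum_coords N d r))"
  unfolding stratum_closure_def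
proof (rule has_zdim_zclosure_range)
  show "(\<lambda>X. stratum_param N d r X k a c) \<in> polyfun" for k a c by (rule polyfun_stratum_param)
  show "finite (stratum_coords N d r)" by (rule finite_stratum_coords)
  show "range (stratum_param N d r) \<subseteq> Rep N d" using stratum_param_in_Rep by blast
next
  fix X Y :: rep
  assume eq: "\<And>k a c. (k, a, c) \<in> stratum_coords N d r \<Longrightarrow> X k a c = Y k a c"
  show "stratum_param N d r X = stratum_param N d r Y"
  proof (intro ext)
    fix k a c
    show "stratum_param N d r X k a c = stratum_param N d r Y k a c"
    proof (cases "(k, a, c) \<in> Rep_coords N d")
      case True
      then obtain k' where k: "k = Suc k'" "k' < N" "a < d k" "c < d k'"
        unfolding Rep_coords_def by (cases k) auto
      have le: "r k \<le> r k'" "r k' \<le> d k'" "r k \<le> d k"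
        using rank_seqs_le[OF r] rank_seqs_Suc_le[OF r] k by auto
      have U: "X k a u = Y k a u" if "r k' \<le> u" "u < d k'" for u
        using that k by (intro eq) (auto simp: stratum_coords_def Rep_coords_def)
      have W: "X k b c = Y k b c" if "b < r k" for b
        using that k le by (intro eq) (auto simp: stratum_coords_def Rep_coords_def)
      have Z: "X k a b = Y k a b" if "b < r k" for b
        using that k le by (intro eq) (auto simp: stratum_coords_def Rep_coords_def)
      have Z': "X k' u c = Y k' u c" if u: "c < r k'" "r k' \<le> u" "u < d k'" for u
      proof (rule eq)
        \<comment> \<open>The case \<open>k' = 0\<close> is void, because \<open>r 0 = d 0\<close>
          leaves no such \<open>u\<close>.\<close>
        obtain k'' where k'': "k' = Suc k''" using u rank_seqs_0[OF r] by (cases k') auto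
        have "r k' \<le> r k''" "r k'' \<le> d k''"
          using rank_seqs_le[OF r] rank_seqs_Suc_le[OF r] k k'' by auto
        then show "(k', u, c) \<in> stratum_coords N d r"
          using u k k'' by (auto simp: stratum_coords_def Rep_coords_def)
      qed
      show ?thesis
        using U W Z Z' k unfolding stratum_param_def by (auto intro!: sum.cong arg_cong2[of _ _ _ _ minus])
    qed (simp add: stratum_param_def)
  qed
next
  fix X :: rep and k a c
  assume P: "(k, a, c) \<in> stratum_coords N d r"
    and base: "\<And>k' a' c'. (k', a', c') \<in> stratum_coords N d r \<Longrightarrow>
      (case (k, a, c) of (k, a, c) \<Rightarrow> if r (k - 1) \<le> c then 2 else if a < r k then 1 else (0::nat))
      < (case (k', a', c') of (k, a, c) \<Rightarrow> if r (k - 1) \<le> c then 2 else if a < r k then 1 else (0::nat)) \<Longrightarrow>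
      X k' a' c' = stratum_base r k' a' c'"
  then obtain k' where k: "k = Suc k'" "k' < N" "a < d k" "c < d k'"
    unfolding stratum_coords_def Rep_coords_def by (cases k) auto
  have le: "r k \<le> r k'" "r k' \<le> d k'" "r k \<le> d k"
    using rank_seqs_le[OF r] rank_seqs_Suc_le[OF r] k by auto
  show "stratum_param N d r X k a c = X k a c"
  proof (cases "r k' \<le> c")
    case True
    then show ?thesis using k by (simp add: stratum_param_def Rep_coords_def)
  next
    case False
    have U: "X k a u = 0" if "r k' \<le> u" "u < d k'" for u
    proof -
      have "X k a u = stratum_base r k a u"
        using that k False by (intro base) (auto simp: stratum_coords_def Rep_coords_def)
      then show ?thesis using that le unfolding stratum_base_def by auto
    qed
    show ?thesis
    proof (cases "a < r k")
      case True
      then show ?thesis using U k False by (simp add: stratum_param_def Rep_coords_def)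
    next
      case a: False
      have W: "X k b c = (if b = c then 1 else 0)" if "b < r k" for b
      proof -
        have "X k b c = stratum_base r k b c"
          using that k le False a by (intro base) (auto simp: stratum_coords_def Rep_coords_def)
        then show ?thesis using that unfolding stratum_base_def by auto
      qed
      have "c < r k" using P False a k unfolding stratum_coords_def by auto
      have "(\<Sum>b<r k. X k a b * X k b c) = (\<Sum>b<r k. if b = c then X k a c else 0)"
        using W by (intro sum.cong) auto
      then show ?thesis using U k False a \<open>c < r k\<close> by (simp add: stratum_param_def Rep_coords_def)
    qed
  qed
qed

lemma prodmat_stratum_base:
  assumes r: "r \<in> rank_seqs N d" and "k \<le> N" "a < r k" "c < r k"
  shows "prodmat d (stratum_param N d r (stratum_base r)) k a c = (if a = c then 1 else 0)"
  using assms(2-)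
proof (induction k arbitrary: a)
  case 0
  then show ?case by simp
next
  case (Suc k)
  have le: "r (Suc k) \<le> r k" "r k \<le> d k" "r (Suc k) \<le> d (Suc k)"
    using rank_seqs_le[OF r] rank_seqs_Suc_le[OF r] Suc.prems by auto
  have A: "stratum_param N d r (stratum_base r) (Suc k) a m = (if m = a then 1 else 0)" if "m < d k" for m
  proof -
    have 0: "stratum_base r (Suc k) a u = 0" if "u \<in> {r k..<d k}" for u
      using that Suc.prems le unfolding stratum_base_def by auto
    show ?thesis using that Suc.prems le 0 by (auto simp: stratum_param_def Rep_coords_def stratum_base_def)
  qed
  have "prodmat d (stratum_param N d r (stratum_base r)) (Suc k) a c
      = (\<Sum>m<d k. if m = a then prodmat d (stratum_param N d r (stratum_base r)) k a c else 0)"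
    unfolding prodmat.simps using A by (intro sum.cong) auto
  also have "\<dots> = prodmat d (stratum_param N d r (stratum_base r)) k a c"
    using Suc.prems le by simp
  finally show ?case using Suc.IH[of a] Suc.prems le by simp
qed

text \<open>Minors of size \<open>Suc (s k)\<close> of the \<open>k\<close>-th partial product
  vanish on the stratum of \<open>s\<close>, hence on its closure. If \<open>r k\<close> exceeded
  \<open>s k\<close>, the leading one would be 1 at the base point of \<open>r\<close>.\<close>

lemma stratum_closure_subset_imp_le:
  assumes r: "r \<in> rank_seqs N d" and s: "s \<in> rank_seqs N d" and "k \<le> N"
    and sub: "stratum_closure N d r \<subseteq> stratum_closure N d s"
  shows "r k \<le> s k"
proof (rule ccontr)
  assume "\<not> r k \<le> s k"
  define n where "n = Suc (s k)"
  have n: "n \<le> r k" "n \<le> d k" "n \<le> d 0"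
    using \<open>\<not> r k \<le> s k\<close> rank_seqs_le[OF r \<open>k \<le> N\<close>] rank_seqs_le_first[OF r \<open>k \<le> N\<close>] unfolding n_def by auto
  define M where "M A = mat n n (\<lambda>(i, j). prodmat d A k i j)" for A
  have dimM: "M A \<in> carrier_mat n n" for A unfolding M_def by simp
  have det_poly: "(\<lambda>A. Determinant.det (M A)) \<in> polyfun"
  proof -
    have "Determinant.det (M A) = (\<Sum>p\<in>{p. p permutes {0..<n}}. signof p * (\<Prod>i = 0..<n. prodmat d A k i (p i)))" for A
    proof -
      have "p i < n" if "p permutes {0..<n}" "i < n" for p i
        using permutes_in_image[OF that(1), of i] that(2) by simp
      then show ?thesis
        unfolding det_def'[OF dimM] by (intro sum.cong refl arg_cong2[of _ _ _ _ times] prod.cong) (auto simp: M_def)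
    qed
    then show ?thesis by (auto intro!: polyfun_sum polyfun.mult polyfun.const polyfun_prod polyfun_prodmat)
  qed
  have det_0: "Determinant.det (M A) = 0" if A: "A \<in> range (stratum_param N d s)" for A
  proof -
    obtain X where X: "A = stratum_param N d s X" using A by blast
    obtain Q where Q: "\<And>a c. a < d k \<Longrightarrow> c < d 0 \<Longrightarrow> prodmat d A k a c = (\<Sum>b<s k. image_basis s X k a b * Q b c)"
      using prodmat_stratum_param[OF s \<open>k \<le> N\<close>, of X] X by blast
    \<comment> \<open>A kernel vector exists since \<open>Q\<close> has one more column than rows
      here; it is then killed by the whole minor.\<close>
    obtain y where y: "\<exists>c\<in>{..<n}. y c \<noteq> 0" "\<forall>b\<in>{..<s k}. (\<Sum>c<n. Q b c * y c) = 0"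
      using homogeneous_system_nontrivial[of "{..<s k}" "{..<n}" Q] n_def by (metis card_lessThan finite_lessThan lessI)
    have "M A *\<^sub>v vec n y = 0\<^sub>v n"
    proof (rule eq_vecI)
      fix i assume "i < dim_vec (0\<^sub>v n :: complex vec)"
      then have i: "i < n" by simp
      have "(M A *\<^sub>v vec n y) $ i = (\<Sum>c<n. prodmat d A k i c * y c)"
        using i by (simp add: M_def scalar_prod_def lessThan_atLeast0)
      also have "\<dots> = (\<Sum>c<n. (\<Sum>b<s k. image_basis s X k i b * Q b c) * y c)"
        using Q n i by (intro sum.cong) auto
      also have "\<dots> = (\<Sum>b<s k. image_basis s X k i b * (\<Sum>c<n. Q b c * y c))"
        by (simp add: sum_distrib_left sum_distrib_right mult.assoc sum.swap[of _ "{..<n}"])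
      also have "\<dots> = 0" using y(2) by simp
      finally show "(M A *\<^sub>v vec n y) $ i = 0\<^sub>v n $ i" using i by simp
    qed (simp add: M_def)
    moreover have "vec n y \<noteq> 0\<^sub>v n"
    proof
      assume "vec n y = 0\<^sub>v n"
      then have "y c = 0" if "c < n" for c using that by (metis index_vec index_zero_vec(1))
      then show False using y(1) by auto
    qed
    ultimately show ?thesis using det_0_iff_vec_prod_zero_field[OF dimM] vec_carrier by blast
  qed
  have "Determinant.det (M A) = 0" if "A \<in> stratum_closure N d s" for A
    using zclosure_vanish[OF that[unfolded stratum_closure_def] det_poly det_0] .
  moreover have "stratum_param N d r (stratum_base r) \<in> stratum_closure N d r"
    unfolding stratum_closure_def using subset_zclosure[of "range (stratum_param N d r)"] stratum_param_in_Rep by blast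
  moreover have "M (stratum_param N d r (stratum_base r)) = 1\<^sub>m n"
    using prodmat_stratum_base[OF r \<open>k \<le> N\<close>] n by (intro eq_matI) (auto simp: M_def)
  ultimately show False using sub by (metis det_one subsetD zero_neq_one)
qed

lemma inj_on_stratum_closure: "inj_on (stratum_closure N d) (rank_seqs N d)"
proof (rule inj_onI)
  fix r s assume r: "r \<in> rank_seqs N d" and s: "s \<in> rank_seqs N d"
    and eq: "stratum_closure N d r = stratum_closure N d s"
  show "r = s"
  proof
    fix k
    show "r k = s k"
    proof (cases "k \<le> N")
      case True
      then show ?thesis
        using stratum_closure_subset_imp_le[OF r s True] stratum_closure_subset_imp_le[OF s r True] eq by simp
    next
      case False
      then show ?thesis using r s unfolding rank_seqs_def by simp
    qed
  qed
qed

section \<open>The strata exhaust the zero locus\<close>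

text \<open>If \<open>C\<close> were smaller, \<open>H\<close> would have a nonzero kernel vector,
  which the product of \<open>F\<close> and \<open>H\<close>, an identity matrix, fixes.\<close>

lemma card_le_of_factor_identity:
  fixes F :: "'a \<Rightarrow> 'b \<Rightarrow> 'c::field"
  assumes "finite J" "finite C"
    and "\<And>a b. a \<in> J \<Longrightarrow> b \<in> J \<Longrightarrow> (\<Sum>c\<in>C. F a c * H c b) = (if a = b then 1 else 0)"
  shows "card J \<le> card C"
proof (rule ccontr)
  assume "\<not> card J \<le> card C"
  then obtain y where y: "\<exists>b\<in>J. y b \<noteq> 0" "\<forall>c\<in>C. (\<Sum>b\<in>J. H c b * y b) = 0"
    using homogeneous_system_nontrivial[OF assms(2,1), of H] by (metis not_le)
  have "y a = 0" if "a \<in> J" for a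
  proof -
    have "0 = (\<Sum>c\<in>C. F a c * (\<Sum>b\<in>J. H c b * y b))" using y(2) by simp
    also have "\<dots> = (\<Sum>b\<in>J. (\<Sum>c\<in>C. F a c * H c b) * y b)"
      by (simp add: sum_distrib_left sum_distrib_right mult.assoc sum.swap[of _ C])
    also have "\<dots> = (\<Sum>b\<in>J. if b = a then y a else 0)"
      using assms(3)[OF that] by (intro sum.cong) auto
    also have "\<dots> = y a" using that assms(1) by simp
    finally show ?thesis by simp
  qed
  then show False using y(1) by blast
qed

text \<open>The rows in \<open>J\<close> form a basis of the row space: \<open>R\<close> is a right inverse of that submatrix, and
  \<open>M R\<close> expresses every row in this basis.\<close>

lemma row_basis:
  fixes M :: "nat \<Rightarrow> nat \<Rightarrow> 'a::field"
  shows "\<exists>J R. J \<subseteq> {..<n} \<and>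
    (\<forall>a<n. \<forall>c<q. M a c = (\<Sum>b\<in>J. (\<Sum>c'<q. M a c' * R c' b) * M b c)) \<and>
    (\<forall>a\<in>J. \<forall>b\<in>J. (\<Sum>c<q. M a c * R c b) = (if a = b then 1 else 0))"
proof (induction n)
  case 0
  then show ?case by auto
next
  case (Suc n)
  then obtain J R where J: "J \<subseteq> {..<n}"
    and span: "\<And>a c. a < n \<Longrightarrow> c < q \<Longrightarrow> M a c = (\<Sum>b\<in>J. (\<Sum>c'<q. M a c' * R c' b) * M b c)"
    and inv: "\<And>a b. a \<in> J \<Longrightarrow> b \<in> J \<Longrightarrow> (\<Sum>c<q. M a c * R c b) = (if a = b then 1 else 0)"
    by blast
  have "finite J" "n \<notin> J" using J finite_subset by auto
  define w where "w c = M n c - (\<Sum>b\<in>J. (\<Sum>c'<q. M n c' * R c' b) * M b c)" for c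
  show ?case
  proof (cases "\<forall>c<q. w c = 0")
    case True
    have "M a c = (\<Sum>b\<in>J. (\<Sum>c'<q. M a c' * R c' b) * M b c)" if "a < Suc n" "c < q" for a c
      using that span[of a c] True unfolding w_def by (cases "a = n") auto
    then show ?thesis using J inv by (intro exI[of _ J] exI[of _ R]) auto
  next
    case False
    then obtain c0 where c0: "c0 < q" "w c0 \<noteq> 0" by blast
    \<comment> \<open>The unit vector at \<open>c0\<close>, corrected so that all earlier rows
      annihilate it. The new row sends it to \<open>w c0\<close>; scaled, it is the new column of
      the right inverse, and multiples of it adjust the old columns to the new row.\<close>
    define v where "v c = (if c = c0 then 1 else 0) - (\<Sum>b\<in>J. R c b * M b c0)" for c
    have Mv: "(\<Sum>c<q. M a c * v c) = M a c0 - (\<Sum>b\<in>J. (\<Sum>c'<q. M a c' * R c' b) * M b c0)" for a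
    proof -
      have "(\<Sum>c<q. M a c * v c) = (\<Sum>c<q. (if c = c0 then M a c0 else 0) - M a c * (\<Sum>b\<in>J. R c b * M b c0))"
        unfolding v_def by (intro sum.cong) (auto simp: algebra_simps)
      also have "\<dots> = M a c0 - (\<Sum>c<q. M a c * (\<Sum>b\<in>J. R c b * M b c0))"
        using c0 by (simp add: sum_subtractf)
      also have "(\<Sum>c<q. M a c * (\<Sum>b\<in>J. R c b * M b c0)) = (\<Sum>b\<in>J. (\<Sum>c'<q. M a c' * R c' b) * M b c0)"
        by (simp add: sum_distrib_left sum_distrib_right mult.assoc sum.swap[of _ "{..<q}"])
      finally show ?thesis .
    qed
    have Mv0: "(\<Sum>c<q. M a c * v c) = 0" if "a < n" for a using span[OF that c0(1)] Mv[of a] by simp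
    have Mvn: "(\<Sum>c<q. M n c * v c) = w c0" unfolding Mv w_def ..
    define R' where "R' c b = (if b = n then v c / w c0
       else R c b - v c * ((\<Sum>c'<q. M n c' * R c' b) / w c0))" for c b
    have R'n: "(\<Sum>c<q. M a c * R' c n) = (\<Sum>c<q. M a c * v c) / w c0" for a
      unfolding R'_def by (simp add: sum_divide_distrib)
    have R'b: "(\<Sum>c<q. M a c * R' c b) = (\<Sum>c<q. M a c * R c b)
        - (\<Sum>c<q. M a c * v c) * ((\<Sum>c'<q. M n c' * R c' b) / w c0)" if "b \<in> J" for a b
    proof -
      define K where "K = (\<Sum>c'<q. M n c' * R c' b) / w c0"
      have "(\<Sum>c<q. M a c * R' c b) = (\<Sum>c<q. M a c * R c b - M a c * v c * K)"
        using that \<open>n \<notin> J\<close> unfolding R'_def K_def[symmetric]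
        by (intro sum.cong) (auto simp: algebra_simps)
      then show ?thesis unfolding K_def[symmetric] by (simp add: sum_subtractf sum_distrib_right)
    qed
    have low: "(\<Sum>c<q. M a c * R' c b) = (if b = n then 0 else \<Sum>c<q. M a c * R c b)"
      if "a < n" "b \<in> insert n J" for a b
      using that R'n[of a] R'b[of b a] Mv0[of a] by auto
    have top: "(\<Sum>c<q. M n c * R' c b) = (if b = n then 1 else 0)" if "b \<in> insert n J" for b
      using that R'n[of n] R'b[of b n] Mvn c0(2) by auto
    have "M a c = (\<Sum>b\<in>insert n J. (\<Sum>c'<q. M a c' * R' c' b) * M b c)" if "a < Suc n" "c < q" for a c
    proof (cases "a = n")
      case True
      have "(\<Sum>b\<in>insert n J. (\<Sum>c'<q. M n c' * R' c' b) * M b c) = (\<Sum>b\<in>insert n J. if b = n then M n c else 0)"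
        using top by (intro sum.cong) auto
      then show ?thesis using True \<open>finite J\<close> by simp
    next
      case False
      then have "a < n" using that by simp
      have "(\<Sum>b\<in>insert n J. (\<Sum>c'<q. M a c' * R' c' b) * M b c)
          = (\<Sum>b\<in>J. (\<Sum>c'<q. M a c' * R' c' b) * M b c)"
        using \<open>finite J\<close> \<open>n \<notin> J\<close> low[OF \<open>a < n\<close>, of n] by simp
      also have "\<dots> = (\<Sum>b\<in>J. (\<Sum>c'<q. M a c' * R c' b) * M b c)"
        using low[OF \<open>a < n\<close>] \<open>n \<notin> J\<close> by (intro sum.cong) auto
      finally show ?thesis using span[OF \<open>a < n\<close> that(2)] by simp
    qed
    moreover have "(\<Sum>c<q. M a c * R' c b) = (if a = b then 1 else 0)"
      if "a \<in> insert n J" "b \<in> insert n J" for a b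
    proof (cases "a = n")
      case True
      then show ?thesis using top[OF that(2)] by auto
    next
      case False
      then have "a \<in> J" "a < n" using that J by auto
      then show ?thesis using low[of a b] inv[of a b] that \<open>n \<notin> J\<close> by auto
    qed
    moreover have "insert n J \<subseteq> {..<Suc n}" using J by auto
    ultimately show ?thesis by blast
  qed
qed

text \<open>\<open>B k\<close> is a basis matrix of a subspace of dimension \<open>card (I k)\<close> that is a graph over the
  coordinates in \<open>I k\<close>, with columns labelled by \<open>I k\<close>, and \<open>A (Suc k)\<close> maps the \<open>k\<close>-th subspace into
  the next one.\<close>

definition chart_data :: "nat \<Rightarrow> (nat \<Rightarrow> nat) \<Rightarrow> (nat \<Rightarrow> nat set) \<Rightarrow> rep \<Rightarrow> rep \<Rightarrow> rep \<Rightarrow> bool" where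
  "chart_data N d I A B W \<longleftrightarrow>
     (\<forall>k\<le>N. I k \<subseteq> {..<d k}) \<and>
     (\<forall>k\<le>N. \<forall>u\<in>I k. \<forall>b\<in>I k. B k u b = (if u = b then 1 else 0)) \<and>
     (\<forall>k<N. \<forall>a<d (Suc k). \<forall>c\<in>I k.
        (\<Sum>v<d k. A (Suc k) a v * B k v c) = (\<Sum>b\<in>I (Suc k). B (Suc k) a b * W (Suc k) b c))"

lemma chart_dataD:
  assumes "chart_data N d I A B W"
  shows "k \<le> N \<Longrightarrow> I k \<subseteq> {..<d k}"
    and "k \<le> N \<Longrightarrow> u \<in> I k \<Longrightarrow> b \<in> I k \<Longrightarrow> B k u b = (if u = b then 1 else 0)"
    and "k < N \<Longrightarrow> a < d (Suc k) \<Longrightarrow> c \<in> I k \<Longrightarrow>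
      (\<Sum>v<d k. A (Suc k) a v * B k v c) = (\<Sum>b\<in>I (Suc k). B (Suc k) a b * W (Suc k) b c)"
  using assms unfolding chart_data_def by auto

lemma chart_data_finite: "chart_data N d I A B W \<Longrightarrow> k \<le> N \<Longrightarrow> finite (I k)"
  using finite_subset[OF chart_dataD(1)] by blast

text \<open>Row bases of the partial products \<open>P k\<close> label the charts. Since
  \<open>P k\<close> is \<open>B k\<close> times its rows in \<open>I k\<close>, the columns of
  \<open>B k\<close> span its image, and \<open>A (Suc k)\<close> times \<open>B k\<close> equals
  \<open>P (Suc k)\<close> times \<open>R k\<close>, that is \<open>B (Suc k)\<close> times
  \<open>W (Suc k)\<close>.\<close>

lemma Sigma0_chart_data:
  assumes "A \<in> Sigma0 N d"
  obtains r I B W where "r \<in> rank_seqs N d" "\<And>k. k \<le> N \<Longrightarrow> card (I k) = r k" "chart_data N d I A B W"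
proof -
  define P where "P = prodmat d A"
  define Q where "Q k J R \<longleftrightarrow> J \<subseteq> {..<d k} \<and>
    (\<forall>a<d k. \<forall>c<d 0. P k a c = (\<Sum>b\<in>J. (\<Sum>c'<d 0. P k a c' * R c' b) * P k b c)) \<and>
    (\<forall>a\<in>J. \<forall>b\<in>J. (\<Sum>c<d 0. P k a c * R c b) = (if a = b then 1 else 0))" for k J R
  have "\<exists>J R. Q k J R" for k unfolding Q_def by (rule row_basis)
  then obtain I R where "\<And>k. Q k (I k) (R k)" by metis
  then have I: "\<And>k. I k \<subseteq> {..<d k}"
    and span: "\<And>k a c. a < d k \<Longrightarrow> c < d 0 \<Longrightarrow> P k a c = (\<Sum>b\<in>I k. (\<Sum>c'<d 0. P k a c' * R k c' b) * P k b c)"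
    and inv: "\<And>k a b. a \<in> I k \<Longrightarrow> b \<in> I k \<Longrightarrow> (\<Sum>c<d 0. P k a c * R k c b) = (if a = b then 1 else 0)"
    unfolding Q_def by auto
  have finI: "finite (I k)" for k using I finite_subset by blast
  define B where "B k u b = (\<Sum>c<d 0. P k u c * R k c b)" for k u b
  define W where "W k b c = (\<Sum>c'<d 0. P k b c' * R (k - 1) c' c)" for k b c
  have P_Suc: "P (Suc k) a c = (\<Sum>v<d k. A (Suc k) a v * P k v c)" for k a c
    unfolding P_def by simp
  have spanB: "P k a c = (\<Sum>b\<in>I k. B k a b * P k b c)" if "a < d k" "c < d 0" for k a c
    using span[OF that] unfolding B_def .
  have rel: "(\<Sum>v<d k. A (Suc k) a v * B k v c) = (\<Sum>b\<in>I (Suc k). B (Suc k) a b * W (Suc k) b c)"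
    if "a < d (Suc k)" for k a c
  proof -
    have "(\<Sum>v<d k. A (Suc k) a v * B k v c) = (\<Sum>c'<d 0. P (Suc k) a c' * R k c' c)"
      unfolding B_def P_Suc by (simp add: sum_distrib_left sum_distrib_right mult.assoc sum.swap[of _ "{..<d k}"])
    also have "\<dots> = (\<Sum>c'<d 0. (\<Sum>b\<in>I (Suc k). B (Suc k) a b * P (Suc k) b c') * R k c' c)"
      using spanB[OF that] by (intro sum.cong) auto
    also have "\<dots> = (\<Sum>b\<in>I (Suc k). B (Suc k) a b * W (Suc k) b c)"
      unfolding W_def by (simp add: sum_distrib_left sum_distrib_right mult.assoc sum.swap[of _ "{..<d 0}"])
    finally show ?thesis .
  qed
  have "chart_data N d I A B W" unfolding chart_data_def using I inv rel by (auto simp: B_def)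
  moreover define r where "r k = (if k \<le> N then card (I k) else 0)" for k
  moreover have "r \<in> rank_seqs N d"
  proof -
    have le_d: "card (I k) \<le> d k" for k using card_mono[OF _ I] by (metis card_lessThan finite_lessThan)
    have "card {..<d 0} \<le> card (I 0)"
    proof (rule card_le_of_factor_identity[OF _ finI])
      fix a b assume "a \<in> {..<d 0}" "b \<in> {..<d 0}"
      then show "(\<Sum>c\<in>I 0. B 0 a c * P 0 c b) = (if a = b then 1 else 0)"
        using spanB[of a 0 b] by (simp add: P_def)
    qed simp
    then have "card (I 0) = d 0" using le_d[of 0] by simp
    \<comment> \<open>The identity matrix on \<open>I (Suc k)\<close> factors through
      \<open>I k\<close>, as \<open>P (Suc k)\<close> is built from the rows of \<open>P k\<close>
      labelled by \<open>I k\<close>.\<close>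
    moreover have "card (I (Suc k)) \<le> card (I k)" for k
    proof (rule card_le_of_factor_identity[OF finI finI])
      fix a b assume ab: "a \<in> I (Suc k)" "b \<in> I (Suc k)"
      have "(if a = b then 1 else 0) = (\<Sum>c<d 0. P (Suc k) a c * R (Suc k) c b)" using inv[OF ab] by simp
      also have "\<dots> = (\<Sum>c<d 0. (\<Sum>v<d k. A (Suc k) a v * (\<Sum>e\<in>I k. B k v e * P k e c)) * R (Suc k) c b)"
        unfolding P_Suc using spanB by (intro sum.cong arg_cong2[of _ _ _ _ times] refl) auto
      also have "\<dots> = (\<Sum>c<d 0. (\<Sum>e\<in>I k. (\<Sum>v<d k. A (Suc k) a v * B k v e) * P k e c) * R (Suc k) c b)"
        by (simp add: sum_distrib_left sum_distrib_right mult.assoc sum.swap[of _ "{..<d k}"])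
      also have "\<dots> = (\<Sum>e\<in>I k. (\<Sum>v<d k. A (Suc k) a v * B k v e) * (\<Sum>c<d 0. P k e c * R (Suc k) c b))"
        unfolding sum_distrib_left[of "\<Sum>v<d k. A (Suc k) a v * B k v e" for e] sum_distrib_right[of _ "I k"]
        by (subst sum.swap) (simp add: mult.assoc)
      finally show "(\<Sum>e\<in>I k. (\<Sum>v<d k. A (Suc k) a v * B k v e) * (\<Sum>c<d 0. P k e c * R (Suc k) c b))
          = (if a = b then 1 else 0)" by simp
    qed
    moreover have "I N = {}"
    proof (rule ccontr)
      assume "I N \<noteq> {}"
      then obtain a where a: "a \<in> I N" by blast
      have "P N a c = 0" if "c < d 0" for c
        using assms that a I[of N] unfolding Sigma0_def P_def by auto
      then show False using inv[OF a a] by simp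
    qed
    ultimately show ?thesis using le_d unfolding rank_seqs_def r_def by auto
  qed
  ultimately show ?thesis using that[of r I B W] by simp
qed

text \<open>The parameters can be read off: U from \<open>A\<close>, W from \<open>W\<close>, Z from
  \<open>B\<close>. Solving the chart relation for the left block of \<open>A\<close> gives back the
  parametrisation formula.\<close>

lemma chart_data_standard:
  assumes r: "r \<in> rank_seqs N d" and A: "A \<in> Rep N d"
    and cd: "chart_data N d I A B W" and I: "\<And>k. k \<le> N \<Longrightarrow> I k = {..<r k}"
  shows "A \<in> range (stratum_param N d r)"
proof -
  define X :: rep where "X k a c = (if r (k - 1) \<le> c then A k a c else if a < r k then W k a c else B k a c)" for k a c
  have "stratum_param N d r X k a c = A k a c" for k a c
  proof (cases "(k, a, c) \<in> Rep_coords N d")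
    case False
    then show ?thesis using A unfolding stratum_param_def Rep_def Rep_coords_def by auto
  next
    case True
    then obtain k' where k: "k = Suc k'" "k' < N" "a < d k" "c < d k'"
      unfolding Rep_coords_def by (cases k) auto
    have le: "r k \<le> r k'" "r k' \<le> d k'" "r k \<le> d k"
      using rank_seqs_le[OF r] rank_seqs_Suc_le[OF r] k by auto
    show ?thesis
    proof (cases "r k' \<le> c")
      case True
      then show ?thesis using k by (simp add: stratum_param_def X_def Rep_coords_def)
    next
      case False
      have "(\<Sum>v<r k'. A k a v * B k' v c) = (\<Sum>v<r k'. if v = c then A k a c else 0)"
        using chart_dataD(2)[OF cd, of k'] I[of k'] k False by (intro sum.cong) auto
      then have Ac: "A k a c = (\<Sum>b<r k. B k a b * W k b c) - (\<Sum>u\<in>{r k'..<d k'}. A k a u * B k' u c)"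
        using chart_dataD(3)[OF cd, of k' a c] k False I[of k'] I[of k]
        by (simp add: sum_lessThan_split[OF le(2)] algebra_simps)
      have "(\<Sum>u\<in>{r k'..<d k'}. X k a u * X k' u c) = (\<Sum>u\<in>{r k'..<d k'}. A k a u * B k' u c)"
      proof (rule sum.cong)
        fix u assume u: "u \<in> {r k'..<d k'}"
        then obtain k'' where k'': "k' = Suc k''" using rank_seqs_0[OF r] by (cases k') auto
        then have "r k' \<le> r (k' - 1)" using rank_seqs_Suc_le[OF r, of k''] k by simp
        then show "X k a u * X k' u c = A k a u * B k' u c" using u k False by (simp add: X_def)
      qed simp
      moreover have "(if a < r k then X k a c else \<Sum>b<r k. X k a b * X k b c) = (\<Sum>b<r k. B k a b * W k b c)"
      proof (cases "a < r k")
        case True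
        have "(\<Sum>b<r k. B k a b * W k b c) = (\<Sum>b<r k. if b = a then W k a c else 0)"
          using chart_dataD(2)[OF cd, of k a] I[of k] k True by (intro sum.cong) auto
        then show ?thesis using True k False by (simp add: X_def)
      next
        case a: False
        then show ?thesis using k le False by (auto simp: X_def intro!: sum.cong)
      qed
      moreover have "k - 1 = k'" using k by simp
      ultimately show ?thesis using Ac False True by (simp add: stratum_param_def)
    qed
  qed
  then show ?thesis by (metis ext rangeI)
qed

text \<open>A change of basis of the \<open>k\<close>-th subspace: column \<open>i\<close>, divided
  by its entry in row \<open>j\<close>, takes the label \<open>j\<close> and clears row
  \<open>j\<close> in the other columns. \<open>W k\<close> and \<open>W (Suc k)\<close> absorb the
  change, so \<open>A\<close> stays the same.\<close>

lemma chart_data_exchange: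
  assumes cd: "chart_data N d I A B W" and k: "1 \<le> k" "k \<le> N"
    and i: "i \<in> I k" and j: "j \<notin> I k" "j < d k" and \<beta>: "B k j i \<noteq> 0"
  shows "\<exists>B' W'. chart_data N d (I(k := insert j (I k - {i}))) A B' W'"
proof -
  define \<beta> where "\<beta> = B k j i"
  define B' where "B' = B(k := \<lambda>u c. if c = j then B k u i / \<beta> else B k u c - B k u i * (B k j c / \<beta>))"
  \<comment> \<open>Over a graph, the coordinate labelled \<open>j\<close> of a vector is its
    \<open>j\<close>-th entry; hence the new row of \<open>W k\<close> is row \<open>j\<close> of
    \<open>B k\<close> times \<open>W k\<close>.\<close>
  define W' where "W' = W(k := \<lambda>b c. if b = j then \<Sum>b\<in>I k. B k j b * W k b c else W k b c,
     Suc k := \<lambda>b c. if c = j then W (Suc k) b i / \<beta>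
       else W (Suc k) b c - W (Suc k) b i * (B k j c / \<beta>))"
  define I' where "I' = I(k := insert j (I k - {i}))"
  have \<beta>0: "\<beta> \<noteq> 0" using \<beta> unfolding \<beta>_def .
  have fin: "finite (I k)" using chart_data_finite[OF cd k(2)] .
  have "chart_data N d I' A B' W'"
    unfolding chart_data_def
  proof (intro conjI allI impI ballI)
    fix l assume "l \<le> N"
    then show "I' l \<subseteq> {..<d l}" using chart_dataD(1)[OF cd, of l] j unfolding I'_def by auto
  next
    fix l u b assume l: "l \<le> N" and u: "u \<in> I' l" and b: "b \<in> I' l"
    show "B' l u b = (if u = b then 1 else 0)"
    proof (cases "l = k")
      case False
      then show ?thesis using chart_dataD(2)[OF cd l] u b unfolding B'_def I'_def by simp
    next
      case True
      have u': "u = j \<or> u \<in> I k \<and> u \<noteq> i \<and> u \<noteq> j" and b': "b = j \<or> b \<in> I k \<and> b \<noteq> i \<and> b \<noteq> j"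
        using u b j(1) True unfolding I'_def by auto
      have "B k u i = 0" if "u \<noteq> j" using that u' chart_dataD(2)[OF cd k(2), of u i] i by auto
      moreover have "B k u b = (if u = b then 1 else 0)" if "u \<noteq> j" "b \<noteq> j"
        using that u' b' chart_dataD(2)[OF cd k(2), of u b] by auto
      ultimately show ?thesis using True \<beta>0 u' b' unfolding B'_def by (auto simp: \<beta>_def)
    qed
  next
    fix l a c assume l: "l < N" and a: "a < d (Suc l)" and c: "c \<in> I' l"
    show "(\<Sum>v<d l. A (Suc l) a v * B' l v c) = (\<Sum>b\<in>I' (Suc l). B' (Suc l) a b * W' (Suc l) b c)"
    proof (cases "l = k")
      case True
      have "(\<Sum>v<d k. A (Suc k) a v * B' k v c) = (\<Sum>b\<in>I (Suc k). B (Suc k) a b * W' (Suc k) b c)"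
      proof (cases "c = j")
        case True
        then show ?thesis
          using chart_dataD(3)[OF cd, of k a i] l a i \<open>l = k\<close>
          by (simp add: B'_def W'_def sum_divide_distrib[symmetric])
      next
        case False
        then have cI: "c \<in> I k" using c \<open>l = k\<close> unfolding I'_def by auto
        have "(\<Sum>v<d k. A (Suc k) a v * B' k v c)
            = (\<Sum>v<d k. A (Suc k) a v * B k v c) - (\<Sum>v<d k. A (Suc k) a v * B k v i) * (B k j c / \<beta>)"
          unfolding sum_distrib_right sum_subtractf[symmetric] using False
          by (intro sum.cong) (auto simp: B'_def algebra_simps)
        also have "\<dots> = (\<Sum>b\<in>I (Suc k). B (Suc k) a b * W (Suc k) b c)
            - (\<Sum>b\<in>I (Suc k). B (Suc k) a b * W (Suc k) b i) * (B k j c / \<beta>)"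
          using chart_dataD(3)[OF cd, of k a] l a i cI \<open>l = k\<close> by simp
        also have "\<dots> = (\<Sum>b\<in>I (Suc k). B (Suc k) a b * W' (Suc k) b c)"
          unfolding sum_distrib_right sum_subtractf[symmetric] using False
          by (intro sum.cong) (auto simp: W'_def algebra_simps)
        finally show ?thesis .
      qed
      then show ?thesis using True unfolding I'_def by (simp add: B'_def)
    next
      case lk: False
      then have c: "c \<in> I l" using c unfolding I'_def by simp
      show ?thesis
      proof (cases "Suc l = k")
        case False
        then show ?thesis using lk chart_dataD(3)[OF cd l a c] unfolding B'_def W'_def I'_def by simp
      next
        case True
        define S where "S = (\<Sum>b\<in>I k - {i}. B k j b * W k b c)"
        have jn: "j \<notin> I k - {i}" using j by simp
        have S: "(\<Sum>b\<in>I k. B k j b * W k b c) = \<beta> * W k i c + S"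
          unfolding S_def \<beta>_def using sum.remove[OF fin i] by simp
        have rest: "(\<Sum>b\<in>I k - {i}. B' k a b * W' k b c)
            = (\<Sum>b\<in>I k - {i}. B k a b * W k b c) - B k a i / \<beta> * S"
          unfolding S_def sum_distrib_left sum_subtractf[symmetric] using j(1)
          by (intro sum.cong) (auto simp: B'_def W'_def algebra_simps)
        have "(\<Sum>b\<in>I' k. B' k a b * W' k b c) = B' k a j * W' k j c + (\<Sum>b\<in>I k - {i}. B' k a b * W' k b c)"
          unfolding I'_def using fin jn by simp
        also have "\<dots> = B k a i / \<beta> * (\<beta> * W k i c + S) + (\<Sum>b\<in>I k - {i}. B k a b * W k b c) - B k a i / \<beta> * S"
          unfolding rest by (simp add: B'_def W'_def S)
        also have "\<dots> = B k a i * W k i c + (\<Sum>b\<in>I k - {i}. B k a b * W k b c)"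
          using \<beta>0 by (simp add: field_simps)
        also have "\<dots> = (\<Sum>b\<in>I k. B k a b * W k b c)"
          using sum.remove[OF fin i, of "\<lambda>b. B k a b * W k b c"] by simp
        also have "\<dots> = (\<Sum>v<d l. A k a v * B l v c)"
          using chart_dataD(3)[OF cd l a c] True by simp
        finally show ?thesis using True lk by (simp add: B'_def)
      qed
    qed
  qed
  then show ?thesis unfolding I'_def by blast
qed

text \<open>Moving the basis vector labelled \<open>i\<close> in direction \<open>j\<close> can be compensated by moving \<open>A\<close> along a
  line, because the coordinates in \<open>I k\<close> provide a left inverse of \<open>B k\<close>.\<close>

definition chart_shift :: "(nat \<Rightarrow> nat set) \<Rightarrow> rep \<Rightarrow> rep \<Rightarrow> nat \<Rightarrow> nat \<Rightarrow> nat \<Rightarrow> rep" where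
  "chart_shift I A W k i j l a v =
     (if l = k then (if a = j \<and> v \<in> I (k - 1) then W k i v else 0)
      else if l = Suc k then (if v = i then - A (Suc k) a j else 0) else 0)"

text \<open>Row \<open>j\<close> of \<open>A k\<close> gains \<open>t\<close> times row
  \<open>i\<close> of \<open>W k\<close>, applied through the identity block of
  \<open>B (k - 1)\<close>. In \<open>A (Suc k)\<close> only column \<open>i\<close> changes: on the
  labels in \<open>I k\<close> it is met by basis vector \<open>i\<close> alone and cancels the
  image of the added vector.\<close>

lemma chart_data_shift:
  assumes cd: "chart_data N d I A B W" and k: "1 \<le> k" "k \<le> N"
    and i: "i \<in> I k" and j: "j \<notin> I k" "j < d k"
  shows "chart_data N d I (line A (chart_shift I A W k i j) t)
    (B(k := \<lambda>u b. B k u b + (if u = j \<and> b = i then t else 0))) W" (is "chart_data N d I ?A ?B W")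
  unfolding chart_data_def
proof (intro conjI allI impI ballI)
  fix l assume "l \<le> N"
  then show "I l \<subseteq> {..<d l}" using chart_dataD(1)[OF cd] by blast
next
  fix l u b assume "l \<le> N" "u \<in> I l" "b \<in> I l"
  then show "?B l u b = (if u = b then 1 else 0)"
    using chart_dataD(2)[OF cd, of l u b] j(1) by auto
next
  fix l a c assume l: "l < N" and a: "a < d (Suc l)" and c: "c \<in> I l"
  note rel = chart_dataD(3)[OF cd l a c]
  have fin: "finite (I k)" using chart_data_finite[OF cd k(2)] .
  show "(\<Sum>v<d l. ?A (Suc l) a v * ?B l v c) = (\<Sum>b\<in>I (Suc l). ?B (Suc l) a b * W (Suc l) b c)"
  proof (cases "l = k")
    case True
    have id: "i < d k" using chart_dataD(1)[OF cd k(2)] i by auto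
    have ij: "i \<noteq> j" using i j by auto
    have Bic: "B k i c = (if c = i then 1 else 0)" using chart_dataD(2)[OF cd k(2) i] c True by auto
    have "(\<Sum>v<d k. ?A (Suc k) a v * ?B k v c)
      = (\<Sum>v<d k. A (Suc k) a v * B k v c + (if v = j then (if c = i then t * A (Suc k) a j else 0) else 0)
          - (if v = i then t * A (Suc k) a j * B k i c else 0))"
      using ij by (intro sum.cong) (auto simp: line_def chart_shift_def algebra_simps)
    also have "\<dots> = (\<Sum>v<d k. A (Suc k) a v * B k v c)"
      using id j(2) Bic by (simp add: sum.distrib sum_subtractf)
    finally show ?thesis using rel True by simp
  next
    case lk: False
    show ?thesis
    proof (cases "Suc l = k")
      case False
      then show ?thesis using lk rel by (simp add: line_def chart_shift_def)
    next
      case True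
      have finl: "finite (I l)" and Il: "I l \<subseteq> {..<d l}" using chart_data_finite[OF cd] chart_dataD(1)[OF cd] l by auto
      have "(\<Sum>v<d l. ?A k a v * ?B l v c)
        = (\<Sum>v<d l. A k a v * B l v c + (if v = c then (if a = j then t * W k i c else 0) else 0))"
        using True lk c chart_dataD(2)[OF cd _ _ c] l
        by (intro sum.cong) (auto simp: line_def chart_shift_def algebra_simps)
      also have "\<dots> = (\<Sum>v<d l. A k a v * B l v c) + (if a = j then t * W k i c else 0)"
        using c Il by (auto simp: sum.distrib)
      also have "(\<Sum>v<d l. A k a v * B l v c) = (\<Sum>b\<in>I k. B k a b * W k b c)" using rel True by simp
      also have "\<dots> + (if a = j then t * W k i c else 0)
        = (\<Sum>b\<in>I k. B k a b * W k b c + (if b = i then (if a = j then t * W k i c else 0) else 0))"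
        using fin i by (simp add: sum.distrib)
      also have "\<dots> = (\<Sum>b\<in>I k. ?B k a b * W k b c)"
        by (intro sum.cong) (auto simp: algebra_simps)
      finally show ?thesis using True by simp
    qed
  qed
qed

lemma line_chart_shift_in_Rep:
  assumes cd: "chart_data N d I A B W" and k: "1 \<le> k" "k \<le> N"
    and i: "i \<in> I k" and j: "j < d k" and A: "A \<in> Rep N d"
  shows "line A (chart_shift I A W k i j) t \<in> Rep N d"
proof -
  have "I (k - 1) \<subseteq> {..<d (k - 1)}" "I k \<subseteq> {..<d k}"
    using chart_dataD(1)[OF cd] k by auto
  then show ?thesis using A i j k unfolding Rep_def line_def chart_shift_def by auto
qed

text \<open>Induction on the number of labels outside the standard position. Shifting by
  \<open>t\<close> makes the entry at \<open>j\<close>, \<open>i\<close> nonzero for every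
  \<open>t\<close> but one; an exchange then lowers the count, so these points of the line lie in
  the closure, and with them the point at \<open>t = 0\<close>.\<close>

lemma chart_data_in_stratum_closure:
  assumes r: "r \<in> rank_seqs N d"
    and "A \<in> Rep N d" "chart_data N d I A B W" "\<And>k. k \<le> N \<Longrightarrow> card (I k) = r k"
  shows "A \<in> stratum_closure N d r"
  using assms(2-)
proof (induction "\<Sum>k\<le>N. card (I k - {..<r k})" arbitrary: I A B W rule: less_induct)
  case less
  note A = less.prems(1) and cd = less.prems(2) and card = less.prems(3)
  show ?case
  proof (cases "\<forall>k\<le>N. I k \<subseteq> {..<r k}")
    case True
    then have "I k = {..<r k}" if "k \<le> N" for k
      using that card[OF that] by (intro card_subset_eq) auto
    then have "A \<in> range (stratum_param N d r)" using chart_data_standard[OF r A cd] by blast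
    then show ?thesis
      unfolding stratum_closure_def using subset_zclosure[of "range (stratum_param N d r)" N d] stratum_param_in_Rep
      by blast
  next
    case False
    then obtain k i where k: "k \<le> N" and i: "i \<in> I k" "r k \<le> i" by (auto simp: subset_iff not_less)
    have fin: "finite (I k)" using chart_data_finite[OF cd k] .
    have "\<not> {..<r k} \<subseteq> I k"
    proof
      assume "{..<r k} \<subseteq> I k"
      then have "insert i {..<r k} \<subseteq> I k" using i by simp
      then have "Suc (r k) \<le> card (I k)" using card_mono[OF fin, of "insert i {..<r k}"] i(2) by simp
      then show False using card[OF k] by simp
    qed
    then obtain j where j: "j < r k" "j \<notin> I k" by auto
    have jd: "j < d k" using j(1) rank_seqs_le[OF r k] by simp
    have "i < d k" using chart_dataD(1)[OF cd k] i by auto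
    \<comment> \<open>No label is misplaced at \<open>k = 0\<close>, where
      \<open>r 0 = d 0\<close>.\<close>
    then have k1: "1 \<le> k" using i(2) rank_seqs_0[OF r] by (cases k) auto
    define Y where "Y = chart_shift I A W k i j"
    define I' where "I' = I(k := insert j (I k - {i}))"
    have cardI': "card (I' l) = r l" if "l \<le> N" for l
      using card[OF that] card_Suc_Diff1[OF fin i(1)] fin j(2) unfolding I'_def
      by (cases "l = k") auto
    have "I' k - {..<r k} = (I k - {..<r k}) - {i}" unfolding I'_def using j by auto
    then have "card (I' k - {..<r k}) < card (I k - {..<r k})"
      using card_Diff1_less[of "I k - {..<r k}" i] i fin by simp
    then have less': "(\<Sum>l\<le>N. card (I' l - {..<r l})) < (\<Sum>l\<le>N. card (I l - {..<r l}))"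
      using k by (intro sum_strict_mono_ex1) (auto simp: I'_def)
    have on_line: "line A Y t \<in> stratum_closure N d r" if "t \<notin> {- B k j i}" for t
    proof -
      let ?B = "B(k := \<lambda>u b. B k u b + (if u = j \<and> b = i then t else 0))"
      have cd': "chart_data N d I (line A Y t) ?B W"
        unfolding Y_def using chart_data_shift[OF cd k1 k i(1) j(2) jd] .
      have "?B k j i \<noteq> 0" using that by (auto simp: add_eq_0_iff)
      then obtain B' W' where "chart_data N d I' (line A Y t) B' W'"
        unfolding I'_def using chart_data_exchange[OF cd' k1 k, of i j] i(1) j(2) jd by blast
      then show ?thesis
        using less.hyps[OF less', of "line A Y t" B' W'] cardI'
          line_chart_shift_in_Rep[OF cd k1 k i(1) jd A] unfolding Y_def by blast
    qed
    have "f A = 0" if f: "f \<in> polyfun" "\<forall>B\<in>range (stratum_param N d r). f B = 0" for f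
    proof -
      have "f (line A Y t) = 0" if "t \<notin> {- B k j i}" for t
        using zclosure_vanish[OF on_line[OF that, unfolded stratum_closure_def] f(1)] f(2) by blast
      then have "f (line A Y 0) = 0" using polyfun_line_eq_0[OF f(1), of "{- B k j i}"] by blast
      then show ?thesis by (simp add: line_def)
    qed
    then show ?thesis using A unfolding stratum_closure_def zclosure_def by blast
  qed
qed

lemma Sigma0_eq_Union_stratum_closure: "Sigma0 N d = (\<Union>r\<in>rank_seqs N d. stratum_closure N d r)"
proof
  show "Sigma0 N d \<subseteq> (\<Union>r\<in>rank_seqs N d. stratum_closure N d r)"
  proof
    fix A assume A: "A \<in> Sigma0 N d"
    then have "A \<in> Rep N d" unfolding Sigma0_def by simp
    then show "A \<in> (\<Union>r\<in>rank_seqs N d. stratum_closure N d r)"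
      using Sigma0_chart_data[OF A] chart_data_in_stratum_closure by (metis UN_iff)
  qed
qed (use stratum_closure_subset_Sigma0 in blast)

section \<open>Dimension and components of the zero locus\<close>

lemma zchain_extend:
  assumes "zchain N d Z n" "zirred N d W" "Z \<subset> W" "W \<subseteq> X"
  shows "zchain N d X (Suc n)"
proof -
  obtain C where C: "\<And>i. i \<le> n \<Longrightarrow> zirred N d (C i)" "\<And>i. i < n \<Longrightarrow> C i \<subset> C (Suc i)" "C n \<subseteq> Z"
    using assms(1) unfolding zchain_def by blast
  show ?thesis
    unfolding zchain_def
  proof (intro exI[of _ "C(Suc n := W)"] conjI allI impI)
    fix i assume "i \<le> Suc n"
    then show "zirred N d ((C(Suc n := W)) i)" using C(1) assms(2) by (auto simp: le_Suc_eq)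
  next
    fix i assume "i < Suc n"
    then show "(C(Suc n := W)) i \<subset> (C(Suc n := W)) (Suc i)"
      using C(2,3) assms(3) by (cases "i = n") auto
  qed (use assms(4) in simp)
qed

lemma zchain_mono: "zchain N d X n \<Longrightarrow> X \<subseteq> Y \<Longrightarrow> zchain N d Y n"
  unfolding zchain_def by (meson order.trans)

lemma rank_seqs_nonempty:
  assumes "1 \<le> N"
  shows "rank_seqs N d \<noteq> {}"
proof -
  have "(\<lambda>k. if k = 0 then d 0 else 0) \<in> rank_seqs N d" using assms unfolding rank_seqs_def by auto
  then show ?thesis by blast
qed

lemma zirred_subset_stratum_closure:
  assumes "zirred N d Z" "Z \<subseteq> Sigma0 N d"
  obtains r where "r \<in> rank_seqs N d" "Z \<subseteq> stratum_closure N d r"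
proof -
  have "\<exists>r\<in>rank_seqs N d. Z \<subseteq> stratum_closure N d r"
  proof (rule zirred_subset_finite_Union[OF assms(1) finite_rank_seqs])
    show "zclosed N d (stratum_closure N d r)" for r
      using zirred_zclosed[OF zirred_stratum_closure] .
  qed (use assms(2) Sigma0_eq_Union_stratum_closure in blast)
  then show ?thesis using that by blast
qed

text \<open>The top of a chain is irreducible and so lies in a single stratum closure, whose
  dimension bounds the chain.\<close>

lemma has_zdim_Sigma0:
  assumes "1 \<le> N"
  shows "has_zdim N d (Sigma0 N d)
    (card (Rep_coords N d) - Min (stratum_codim N d ` rank_seqs N d))"
  unfolding has_zdim_def
proof (intro conjI allI impI)
  let ?m = "Min (stratum_codim N d ` rank_seqs N d)"
  have "?m \<in> stratum_codim N d ` rank_seqs N d"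
    using finite_rank_seqs rank_seqs_nonempty[OF assms] by (intro Min_in) auto
  then obtain r where r: "r \<in> rank_seqs N d" "stratum_codim N d r = ?m" by auto
  then have "zchain N d (stratum_closure N d r) (card (Rep_coords N d) - ?m)"
    using has_zdim_stratum_closure[OF r(1)] card_stratum_coords[OF r(1)] unfolding has_zdim_def by simp
  then show "zchain N d (Sigma0 N d) (card (Rep_coords N d) - ?m)"
    using zchain_mono stratum_closure_subset_Sigma0[OF r(1)] by blast
  fix n assume "zchain N d (Sigma0 N d) n"
  then obtain C where C: "\<And>i. i \<le> n \<Longrightarrow> zirred N d (C i)" "\<And>i. i < n \<Longrightarrow> C i \<subset> C (Suc i)" "C n \<subseteq> Sigma0 N d"
    unfolding zchain_def by blast
  obtain s where s: "s \<in> rank_seqs N d" "C n \<subseteq> stratum_closure N d s"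
    using zirred_subset_stratum_closure[OF C(1)[OF order.refl] C(3)] by blast
  then have "zchain N d (stratum_closure N d s) n" unfolding zchain_def using C by blast
  then have "n \<le> card (stratum_coords N d s)" using has_zdim_stratum_closure[OF s(1)] unfolding has_zdim_def by blast
  moreover have "?m \<le> stratum_codim N d s" using finite_rank_seqs s(1) by auto
  ultimately show "n \<le> card (Rep_coords N d) - ?m" using card_stratum_coords[OF s(1)] by linarith
qed

text \<open>An irreducible subset of \<open>Sigma0 N d\<close> properly containing a stratum closure of maximal dimension
  would yield a longer chain, so such closures are components.\<close>

lemma top_components_Sigma0:
  assumes "1 \<le> N"
  shows "top_components N d (Sigma0 N d) = stratum_closure N d `
    {r \<in> rank_seqs N d. stratum_codim N d r = Min (stratum_codim N d ` rank_seqs N d)}"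
proof -
  define m where "m = Min (stratum_codim N d ` rank_seqs N d)"
  define D where "D = card (Rep_coords N d)"
  have m_le: "m \<le> stratum_codim N d r" if "r \<in> rank_seqs N d" for r
    unfolding m_def using finite_rank_seqs that by auto
  have S: "has_zdim N d (Sigma0 N d) (D - m)" unfolding D_def m_def using has_zdim_Sigma0[OF assms] .
  have Z: "has_zdim N d (stratum_closure N d r) (D - stratum_codim N d r)" "stratum_codim N d r \<le> D"
    if "r \<in> rank_seqs N d" for r
    using has_zdim_stratum_closure[OF that] card_stratum_coords[OF that] unfolding D_def by auto
  have "top_components N d (Sigma0 N d) = stratum_closure N d ` {r \<in> rank_seqs N d. stratum_codim N d r = m}"
  proof (intro equalityI subsetI)
    fix C assume "C \<in> top_components N d (Sigma0 N d)"
    then have C: "C \<subseteq> Sigma0 N d" "zirred N d C" "zdim N d C = D - m"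
      and max: "\<And>W. zirred N d W \<Longrightarrow> C \<subseteq> W \<Longrightarrow> W \<subseteq> Sigma0 N d \<Longrightarrow> W = C"
      using has_zdim_zdim[OF S] unfolding top_components_def irr_components_def by auto
    obtain r where r: "r \<in> rank_seqs N d" "C \<subseteq> stratum_closure N d r"
      using zirred_subset_stratum_closure[OF C(2,1)] by blast
    then have eq: "stratum_closure N d r = C"
      using max[OF zirred_stratum_closure r(2)] stratum_closure_subset_Sigma0 by blast
    then have "D - stratum_codim N d r = D - m" using C(3) has_zdim_zdim[OF Z(1)[OF r(1)]] by simp
    then have "stratum_codim N d r = m" using Z(2)[OF r(1)] m_le[OF r(1)] by simp
    then show "C \<in> stratum_closure N d ` {r \<in> rank_seqs N d. stratum_codim N d r = m}" using eq r(1) by blast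
  next
    fix C assume "C \<in> stratum_closure N d ` {r \<in> rank_seqs N d. stratum_codim N d r = m}"
    then obtain r where r: "r \<in> rank_seqs N d" "stratum_codim N d r = m" and C: "C = stratum_closure N d r" by auto
    have dimC: "has_zdim N d C (D - m)" using Z(1)[OF r(1)] r(2) C by simp
    have "W = C" if W: "zirred N d W" "C \<subseteq> W" "W \<subseteq> Sigma0 N d" for W
    proof (rule ccontr)
      assume "W \<noteq> C"
      then have "C \<subset> W" using W(2) by blast
      then have "zchain N d (Sigma0 N d) (Suc (D - m))"
        using zchain_extend[of N d C "D - m" W "Sigma0 N d"] dimC W unfolding has_zdim_def by simp
      then show False using S unfolding has_zdim_def by fastforce
    qed
    then show "C \<in> top_components N d (Sigma0 N d)"
      using C zirred_stratum_closure stratum_closure_subset_Sigma0[OF r(1)] has_zdim_zdim[OF S] has_zdim_zdim[OF dimC]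
      unfolding top_components_def irr_components_def by auto
  qed
  then show ?thesis unfolding m_def .
qed

lemma card_top_components_Sigma0:
  assumes "1 \<le> N"
  shows "card (top_components N d (Sigma0 N d)) = card
    {r \<in> rank_seqs N d. stratum_codim N d r = Min (stratum_codim N d ` rank_seqs N d)}"
  unfolding top_components_Sigma0[OF assms]
  by (intro card_image inj_on_subset[OF inj_on_stratum_closure]) auto

lemma codim_Sigma0:
  assumes "1 \<le> N"
  shows "zdim N d (Rep N d) - zdim N d (Sigma0 N d) = Min (stratum_codim N d ` rank_seqs N d)"
proof -
  have "Min (stratum_codim N d ` rank_seqs N d) \<in> stratum_codim N d ` rank_seqs N d"
    using finite_rank_seqs rank_seqs_nonempty[OF assms] by (intro Min_in) auto
  \<comment> \<open>Keeps the subtraction of naturals from truncating.\<close>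
  then have "Min (stratum_codim N d ` rank_seqs N d) \<le> card (Rep_coords N d)"
    using card_stratum_coords by (metis imageE le_add2)
  then show ?thesis
    using has_zdim_zdim[OF has_zdim_Rep] has_zdim_zdim[OF has_zdim_Sigma0[OF assms]] by simp
qed

section \<open>Invariance under permutations\<close>

text \<open>For \<open>p = 1 / q\<close> this is the probability that a random \<open>d \<times> r\<close> matrix over the field with \<open>q\<close>
  elements has rank \<open>s\<close>: the next column lies in the span of the previous ones, of dimension \<open>s\<close>,
  with probability \<open>p ^ (d - s)\<close>.\<close>

fun rank_prob :: "real \<Rightarrow> nat \<Rightarrow> nat \<Rightarrow> nat \<Rightarrow> real" where
  "rank_prob p d 0 s = (if s = 0 then 1 else 0)"
| "rank_prob p d (Suc r) 0 = rank_prob p d r 0 * p ^ d"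
| "rank_prob p d (Suc r) (Suc s) =
     rank_prob p d r (Suc s) * p ^ (d - Suc s) + rank_prob p d r s * (1 - p ^ (d - s))"

text \<open>The probability that a random \<open>s \<times> j\<close> matrix has rank \<open>j\<close>; for \<open>s < j\<close> the factor with \<open>i = s\<close>
  vanishes. These functions are simultaneous eigenvectors of all the transition matrices
  \<open>rank_prob p d\<close>.\<close>

definition full_rank_prob :: "real \<Rightarrow> nat \<Rightarrow> nat \<Rightarrow> real" where
  "full_rank_prob p j s = (\<Prod>i<j. 1 - p ^ (s - i))"

text \<open>At \<open>s = d\<close> the factor \<open>1 - p ^ (d - s)\<close> vanishes, so the
  recursion never passes rank \<open>d\<close>; truncated subtraction keeps it zero beyond.\<close>

lemma rank_prob_eq_0: "r < s \<or> d < s \<Longrightarrow> rank_prob p d r s = 0"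
proof (induction p d r s rule: rank_prob.induct)
  case (3 p d r s)
  then have "rank_prob p d r (Suc s) = 0" "rank_prob p d r s * (1 - p ^ (d - s)) = 0" by auto
  then show ?case by simp
qed auto

lemma full_rank_prob_eq_0: "s < j \<Longrightarrow> full_rank_prob p j s = 0"
  unfolding full_rank_prob_def by (auto intro!: bexI[of _ s])

lemma full_rank_prob_self_nonzero:
  assumes "0 < p" "p < 1"
  shows "full_rank_prob p j j \<noteq> 0"
proof -
  have "p ^ (j - i) \<noteq> 1" if "i < j" for i
    using assms that power_Suc_less_one[of p "j - i - 1"] by (simp add: Suc_diff_Suc flip: power_Suc)
  then show ?thesis unfolding full_rank_prob_def by auto
qed

lemma full_rank_prob_Suc: "full_rank_prob p (Suc j) s = full_rank_prob p j s * (1 - p ^ (s - j))"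
  unfolding full_rank_prob_def by simp

lemma full_rank_prob_Suc_Suc: "full_rank_prob p (Suc j) (Suc s) = (1 - p ^ Suc s) * full_rank_prob p j s"
  unfolding full_rank_prob_def by (subst prod.lessThan_Suc_shift) simp

text \<open>For \<open>p = 1 / q\<close>, condition on one row: it is zero with probability
  \<open>p ^ Suc j\<close>; otherwise column operations reduce to one row and one column
  less.\<close>

lemma full_rank_prob_step:
  "full_rank_prob p (Suc j) (Suc s) =
     p ^ Suc j * full_rank_prob p (Suc j) s + (1 - p ^ Suc j) * full_rank_prob p j s"
proof (cases "j \<le> s")
  case True
  then have "p ^ Suc s = p ^ Suc j * p ^ (s - j)" by (simp flip: power_add)
  then show ?thesis unfolding full_rank_prob_Suc_Suc full_rank_prob_Suc[of p j s]
    by (simp del: power_Suc add: algebra_simps)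
qed (simp add: full_rank_prob_Suc_Suc full_rank_prob_Suc full_rank_prob_eq_0)

text \<open>The left side is the expectation after one more column. It closes up in two consecutive
  functions with coefficients independent of \<open>s\<close>, as the induction on columns
  requires.\<close>

lemma full_rank_prob_column:
  assumes "s \<le> d"
  shows "p ^ (d - s) * full_rank_prob p (Suc j) s + (1 - p ^ (d - s)) * full_rank_prob p (Suc j) (Suc s)
    = p ^ Suc j * full_rank_prob p (Suc j) s + (1 - p ^ Suc j) * (1 - p ^ (d - j)) * full_rank_prob p j s"
proof (cases "j \<le> s")
  case True
  obtain x where x: "s = j + x" using True le_Suc_ex by blast
  obtain y where y: "d = s + y" using assms le_Suc_ex by blast
  show ?thesis
    unfolding full_rank_prob_Suc_Suc full_rank_prob_Suc[of p j s]
    by (simp add: x y power_add algebra_simps)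
qed (simp add: full_rank_prob_Suc_Suc full_rank_prob_Suc full_rank_prob_eq_0)

lemma sum_rank_prob_Suc:
  "(\<Sum>s\<le>Suc r. rank_prob p d (Suc r) s * h s)
   = (\<Sum>s\<le>r. rank_prob p d r s * (p ^ (d - s) * h s + (1 - p ^ (d - s)) * h (Suc s)))"
proof -
  have "(\<Sum>s\<le>Suc r. rank_prob p d (Suc r) s * h s)
      = rank_prob p d r 0 * p ^ d * h 0 + (\<Sum>s\<le>r. rank_prob p d r (Suc s) * p ^ (d - Suc s) * h (Suc s))
        + (\<Sum>s\<le>r. rank_prob p d r s * (1 - p ^ (d - s)) * h (Suc s))"
    by (subst sum.atMost_Suc_shift) (simp add: sum.distrib distrib_right)
  also have "rank_prob p d r 0 * p ^ d * h 0 + (\<Sum>s\<le>r. rank_prob p d r (Suc s) * p ^ (d - Suc s) * h (Suc s))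
      = (\<Sum>s\<le>Suc r. rank_prob p d r s * p ^ (d - s) * h s)"
    by (subst sum.atMost_Suc_shift) simp
  also have "\<dots> = (\<Sum>s\<le>r. rank_prob p d r s * p ^ (d - s) * h s)"
    by (simp add: rank_prob_eq_0)
  finally show ?thesis by (simp add: sum.distrib[symmetric] distrib_left mult.assoc del: sum.atMost_Suc)
qed

text \<open>For \<open>p = 1 / q\<close> both sides are the probability that M Y has rank
  \<open>j\<close>, with M random of size \<open>d\<close> by \<open>r\<close> and Y random of size
  \<open>r\<close> by \<open>j\<close>: condition on the rank of M, or first on Y having rank
  \<open>j\<close>. The formal proof adds columns to M one by one.\<close>

lemma rank_prob_eigenvector:
  "(\<Sum>s\<le>r. rank_prob p d r s * full_rank_prob p j s) = full_rank_prob p j r * full_rank_prob p j d"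
proof (induction r arbitrary: j)
  case 0
  show ?case
  proof (cases j)
    case 0
    then show ?thesis by (simp add: full_rank_prob_def)
  next
    case (Suc i)
    then show ?thesis by (simp add: full_rank_prob_eq_0)
  qed
next
  case (Suc r)
  show ?case
  proof (cases j)
    case 0
    then have "full_rank_prob p j s = 1" for s by (simp add: full_rank_prob_def)
    then show ?thesis using Suc[of j] by (simp only: sum_rank_prob_Suc) simp
  next
    case (Suc i)
    have "(\<Sum>s\<le>Suc r. rank_prob p d (Suc r) s * full_rank_prob p j s)
      = (\<Sum>s\<le>r. rank_prob p d r s *
          (p ^ j * full_rank_prob p j s + (1 - p ^ j) * (1 - p ^ (d - i)) * full_rank_prob p i s))"
      unfolding sum_rank_prob_Suc
    proof (rule sum.cong)
      fix s
      show "rank_prob p d r s * (p ^ (d - s) * full_rank_prob p j s + (1 - p ^ (d - s)) * full_rank_prob p j (Suc s))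
        = rank_prob p d r s * (p ^ j * full_rank_prob p j s + (1 - p ^ j) * (1 - p ^ (d - i)) * full_rank_prob p i s)"
        using full_rank_prob_column[of s d p i] rank_prob_eq_0[of r s d p] Suc by (cases "s \<le> d") auto
    qed simp
    also have "\<dots> = p ^ j * (\<Sum>s\<le>r. rank_prob p d r s * full_rank_prob p j s)
        + (1 - p ^ j) * (1 - p ^ (d - i)) * (\<Sum>s\<le>r. rank_prob p d r s * full_rank_prob p i s)"
      unfolding sum_distrib_left sum.distrib[symmetric] by (intro sum.cong) (auto simp: algebra_simps)
    also have "\<dots> = p ^ j * (full_rank_prob p j r * full_rank_prob p j d)
        + (1 - p ^ j) * (1 - p ^ (d - i)) * (full_rank_prob p i r * full_rank_prob p i d)"
      using Suc.IH by simp
    also have "\<dots> = full_rank_prob p j d * (p ^ j * full_rank_prob p j r + (1 - p ^ j) * full_rank_prob p i r)"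
      unfolding Suc full_rank_prob_Suc[of p i d] by (simp add: algebra_simps)
    also have "\<dots> = full_rank_prob p j (Suc r) * full_rank_prob p j d"
      unfolding Suc full_rank_prob_step[of p i r] by simp
    finally show ?thesis .
  qed
qed

section \<open>The Markov chain of ranks of partial products\<close>

fun product_rank_prob :: "real \<Rightarrow> (nat \<Rightarrow> nat) \<Rightarrow> nat \<Rightarrow> nat \<Rightarrow> real" where
  "product_rank_prob p d 0 s = (if s = d 0 then 1 else 0)"
| "product_rank_prob p d (Suc k) s = (\<Sum>r\<le>d 0. product_rank_prob p d k r * rank_prob p (d (Suc k)) r s)"

lemma product_rank_prob_eq_0: "d 0 < s \<Longrightarrow> product_rank_prob p d k s = 0"
  by (cases k) (auto simp: rank_prob_eq_0)

lemma sum_product_rank_prob: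
  "(\<Sum>s\<le>d 0. product_rank_prob p d k s * full_rank_prob p j s) = (\<Prod>i\<le>k. full_rank_prob p j (d i))"
proof (induction k)
  case 0
  have "(\<Sum>s\<le>d 0. product_rank_prob p d 0 s * full_rank_prob p j s)
      = (\<Sum>s\<le>d 0. if s = d 0 then full_rank_prob p j (d 0) else 0)"
    by (rule sum.cong) auto
  then show ?case by simp
next
  case (Suc k)
  have "(\<Sum>s\<le>d 0. product_rank_prob p d (Suc k) s * full_rank_prob p j s)
     = (\<Sum>r\<le>d 0. product_rank_prob p d k r * (\<Sum>s\<le>d 0. rank_prob p (d (Suc k)) r s * full_rank_prob p j s))"
    unfolding product_rank_prob.simps sum_distrib_left sum_distrib_right
    by (subst sum.swap) (simp add: mult.assoc)
  also have "\<dots> = (\<Sum>r\<le>d 0. product_rank_prob p d k r * (full_rank_prob p j r * full_rank_prob p j (d (Suc k))))"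
  proof (intro sum.cong refl arg_cong2[of _ _ _ _ times])
    fix r assume "r \<in> {..d 0}"
    then have "(\<Sum>s\<le>d 0. rank_prob p (d (Suc k)) r s * full_rank_prob p j s)
       = (\<Sum>s\<le>r. rank_prob p (d (Suc k)) r s * full_rank_prob p j s)"
      by (intro sum.mono_neutral_right) (auto simp: rank_prob_eq_0)
    then show "(\<Sum>s\<le>d 0. rank_prob p (d (Suc k)) r s * full_rank_prob p j s)
      = full_rank_prob p j r * full_rank_prob p j (d (Suc k))" using rank_prob_eigenvector by simp
  qed
  also have "\<dots> = (\<Sum>r\<le>d 0. product_rank_prob p d k r * full_rank_prob p j r) * full_rank_prob p j (d (Suc k))"
    by (simp add: sum_distrib_right mult.assoc)
  finally show ?case using Suc by simp
qed

text \<open>The matrix of these functions is triangular with nonzero diagonal, so testing against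
  the function indexed by the largest support point isolates the value there.\<close>

lemma full_rank_prob_separates:
  assumes p: "0 < p" "p < 1" and "\<And>j. (\<Sum>s\<le>M. \<Delta> s * full_rank_prob p j s) = 0" "s \<le> M"
  shows "\<Delta> s = 0"
proof (rule ccontr)
  assume "\<Delta> s \<noteq> 0"
  define S where "S = {s. s \<le> M \<and> \<Delta> s \<noteq> 0}"
  have S: "finite S" "S \<noteq> {}" unfolding S_def using \<open>\<Delta> s \<noteq> 0\<close> \<open>s \<le> M\<close> by auto
  define t where "t = Max S"
  have t: "t \<le> M" "\<Delta> t \<noteq> 0" using Max_in[OF S] unfolding t_def S_def by auto
  have "\<Delta> s * full_rank_prob p t s = 0" if "s \<le> M" "s \<noteq> t" for s
  proof (cases "s < t")
    case False
    then have "s \<notin> S" using Max_ge[OF S(1), of s] that(2) unfolding t_def by auto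
    then show ?thesis using that(1) unfolding S_def by simp
  qed (simp add: full_rank_prob_eq_0)
  then have "(\<Sum>s\<le>M. \<Delta> s * full_rank_prob p t s) = (\<Sum>s\<in>{t}. \<Delta> s * full_rank_prob p t s)"
    using t(1) by (intro sum.mono_neutral_right) auto
  then show False using assms(3)[of t] t(2) full_rank_prob_self_nonzero[OF p, of t] by simp
qed

lemma product_rank_prob_permute:
  assumes p: "0 < p" "p < 1" and perm: "mset (map d [0..<Suc N]) = mset (map d' [0..<Suc N])"
  shows "product_rank_prob p d N s = product_rank_prob p d' N s"
proof (cases "s \<le> max (d 0) (d' 0)")
  case False
  then show ?thesis by (simp add: product_rank_prob_eq_0)
next
  case True
  \<comment> \<open>The two chains start at different ranks; a common range is needed to subtract
    their distributions.\<close>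
  define M where "M = max (d 0) (d' 0)"
  have prods: "(\<Prod>i\<le>N. full_rank_prob p j (d i)) = prod_mset (image_mset (full_rank_prob p j) (mset (map d [0..<Suc N])))"
    for j and d :: "nat \<Rightarrow> nat"
  proof -
    have "(\<Prod>i\<le>N. full_rank_prob p j (d i)) = prod_list (map (\<lambda>i. full_rank_prob p j (d i)) [0..<Suc N])"
      using prod.distinct_set_conv_list[of "[0..<Suc N]" "\<lambda>i. full_rank_prob p j (d i)"]
      by (simp add: atLeast0LessThan lessThan_Suc_atMost del: upt_Suc)
    also have "\<dots> = prod_mset (image_mset (full_rank_prob p j) (mset (map d [0..<Suc N])))"
      by (simp add: prod_mset_prod_list[symmetric] image_mset.compositionality comp_def del: upt_Suc)
    finally show ?thesis .
  qed
  have ext: "(\<Sum>s\<le>M. product_rank_prob p d N s * full_rank_prob p j s) = (\<Prod>i\<le>N. full_rank_prob p j (d i))"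
    if "d 0 \<le> M" for j and d :: "nat \<Rightarrow> nat"
  proof -
    have "(\<Sum>s\<le>M. product_rank_prob p d N s * full_rank_prob p j s)
       = (\<Sum>s\<le>d 0. product_rank_prob p d N s * full_rank_prob p j s)"
      using that by (intro sum.mono_neutral_right) (auto simp: product_rank_prob_eq_0)
    then show ?thesis using sum_product_rank_prob by simp
  qed
  have "(\<Sum>s\<le>M. (product_rank_prob p d N s - product_rank_prob p d' N s) * full_rank_prob p j s) = 0" for j
  proof -
    have "(\<Prod>i\<le>N. full_rank_prob p j (d i)) = (\<Prod>i\<le>N. full_rank_prob p j (d' i))"
      unfolding prods perm ..
    then show ?thesis
      using ext[of d j] ext[of d' j] by (simp add: left_diff_distrib sum_subtractf M_def)
  qed
  then have "product_rank_prob p d N s - product_rank_prob p d' N s = 0"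
    using full_rank_prob_separates[OF p, where M = M and \<Delta> = "\<lambda>s. product_rank_prob p d N s - product_rank_prob p d' N s"] True
    unfolding M_def by blast
  then show ?thesis by simp
qed

text \<open>Summing over the intermediate ranks. For \<open>s = 0\<close> the paths are exactly the
  strata, which ties the symmetric quantity to their codimensions.\<close>

lemma product_rank_prob_eq_sum_paths:
  "product_rank_prob p d k s = (\<Sum>r\<in>rank_paths k d s. \<Prod>i=1..k. rank_prob p (d i) (r (i - 1)) (r i))"
proof (induction k arbitrary: s)
  case 0
  have "rank_paths 0 d s = (if s = d 0 then {\<lambda>i. if i = 0 then s else 0} else {})"
    unfolding rank_paths_def by (auto simp: fun_eq_iff)
  then show ?case by simp
next
  case (Suc k)
  define w where "w r = (\<Prod>i=1..k. rank_prob p (d i) (r (i - 1)) (r i))" for r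
  show ?case
  proof (cases "s \<le> d (Suc k)")
    case False
    then have "rank_paths (Suc k) d s = {}" unfolding rank_paths_def by auto
    then show ?thesis using False by (simp add: rank_prob_eq_0)
  next
    case True
    have "product_rank_prob p d (Suc k) s = (\<Sum>r\<le>d 0. (\<Sum>\<rho>\<in>rank_paths k d r. w \<rho>) * rank_prob p (d (Suc k)) r s)"
      by (simp add: Suc w_def)
    also have "\<dots> = (\<Sum>r\<in>{s..d 0}. (\<Sum>\<rho>\<in>rank_paths k d r. w \<rho>) * rank_prob p (d (Suc k)) r s)"
      by (rule sum.mono_neutral_right) (auto simp: rank_prob_eq_0)
    also have "\<dots> = (\<Sum>(r, \<rho>)\<in>(SIGMA r:{s..d 0}. rank_paths k d r). w \<rho> * rank_prob p (d (Suc k)) r s)"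
      by (subst sum.Sigma[symmetric]) (auto simp: finite_rank_paths sum_distrib_right)
    also have "\<dots> = (\<Sum>r\<in>rank_paths (Suc k) d s. \<Prod>i=1..Suc k. rank_prob p (d i) (r (i - 1)) (r i))"
    proof (rule sum.reindex_bij_witness[where j = "\<lambda>(r, \<rho>). \<rho>(Suc k := s)" and i = "\<lambda>\<rho>. (\<rho> k, \<rho>(Suc k := 0))"])
      fix \<rho> assume \<rho>: "\<rho> \<in> rank_paths (Suc k) d s"
      show "(case (\<rho> k, \<rho>(Suc k := 0)) of (r, \<rho>) \<Rightarrow> \<rho>(Suc k := s)) = \<rho>"
        using \<rho> unfolding rank_paths_def by auto
      show "(\<rho> k, \<rho>(Suc k := 0)) \<in> (SIGMA r:{s..d 0}. rank_paths k d r)"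
        using \<rho> rank_paths_le[OF \<rho>, of k] unfolding rank_paths_def by (auto simp: Suc_lessI)
    next
      fix x assume x: "x \<in> (SIGMA r:{s..d 0}. rank_paths k d r)"
      obtain r \<rho> where x': "x = (r, \<rho>)" "s \<le> r" "\<rho> \<in> rank_paths k d r" using x by auto
      show "((case x of (r, \<rho>) \<Rightarrow> \<rho>(Suc k := s)) k, (case x of (r, \<rho>) \<Rightarrow> \<rho>(Suc k := s))(Suc k := 0)) = x"
        using x' unfolding rank_paths_def by (auto simp: fun_eq_iff)
      show "(case x of (r, \<rho>) \<Rightarrow> \<rho>(Suc k := s)) \<in> rank_paths (Suc k) d s"
        using x' True unfolding rank_paths_def by (auto simp: less_Suc_eq)
      have "w (\<rho>(Suc k := s)) = w \<rho>" unfolding w_def by (intro prod.cong) auto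
      moreover have "\<rho> k = r" using x' unfolding rank_paths_def by simp
      ultimately show "(\<Prod>i = 1..Suc k. rank_prob p (d i) ((case x of (r, \<rho>) \<Rightarrow> \<rho>(Suc k := s)) (i - 1))
            ((case x of (r, \<rho>) \<Rightarrow> \<rho>(Suc k := s)) i))
         = (case x of (r, \<rho>) \<Rightarrow> w \<rho> * rank_prob p (d (Suc k)) r s)"
        using x' by (simp add: w_def)
    qed
    finally show ?thesis .
  qed
qed

section \<open>Leading exponents and coefficients as p tends to 0\<close>

definition leading_power :: "(real \<Rightarrow> real) \<Rightarrow> nat \<Rightarrow> bool" where
  "leading_power f e \<longleftrightarrow> (\<exists>u. (u \<longlongrightarrow> 1) (at_right 0) \<and> (\<forall>p. f p = p ^ e * u p))"

lemma tendsto_power_at_right_0: "0 < n \<Longrightarrow> ((\<lambda>p::real. p ^ n) \<longlongrightarrow> 0) (at_right 0)"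
  using tendsto_power[OF tendsto_ident_at[of "0::real" "{0<..}"], of n] by (simp add: zero_power)

text \<open>Of the two terms of the recursion, the one that increases the rank is smaller by the
  factor \<open>p ^ (r - s')\<close>, so the other dominates, except for \<open>s' = r\<close>,
  where that other term is zero.\<close>

lemma leading_power_rank_prob:
  assumes "s \<le> r" "s \<le> d"
  shows "leading_power (\<lambda>p. rank_prob p d r s) ((d - s) * (r - s))"
  using assms
proof (induction r arbitrary: s)
  case 0
  then show ?case unfolding leading_power_def by (intro exI[of _ "\<lambda>_. 1"]) auto
next
  case (Suc r)
  show ?case
  proof (cases s)
    case 0
    obtain u where u: "(u \<longlongrightarrow> 1) (at_right 0)" "\<And>p. rank_prob p d r 0 = p ^ (d * r) * u p"
      using Suc.IH[of 0] unfolding leading_power_def by auto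
    then show ?thesis
      unfolding leading_power_def 0 by (intro exI[of _ u]) (auto simp: power_add)
  next
    case s: (Suc s')
    then have le: "s' \<le> r" "Suc s' \<le> d" using Suc.prems by auto
    obtain u where u: "(u \<longlongrightarrow> 1) (at_right 0)" "\<And>p. rank_prob p d r s' = p ^ ((d - s') * (r - s')) * u p"
      using Suc.IH[of s'] le unfolding leading_power_def by auto
    have u1: "((\<lambda>p. u p * (1 - p ^ (d - s'))) \<longlongrightarrow> 1 * (1 - 0)) (at_right 0)"
      using le by (intro tendsto_intros u tendsto_power_at_right_0) auto
    show ?thesis
    proof (cases "s' = r")
      case True
      then show ?thesis
        unfolding leading_power_def s using u u1
        by (intro exI[of _ "\<lambda>p. u p * (1 - p ^ (d - s'))"]) (auto simp: rank_prob_eq_0)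
    next
      case False
      then have "s' < r" using le by simp
      obtain v where v: "(v \<longlongrightarrow> 1) (at_right 0)" "\<And>p. rank_prob p d r (Suc s') = p ^ ((d - Suc s') * (r - Suc s')) * v p"
        using Suc.IH[of "Suc s'"] le \<open>s' < r\<close> unfolding leading_power_def by auto
      have "((\<lambda>p. v p + p ^ (r - s') * (u p * (1 - p ^ (d - s')))) \<longlongrightarrow> 1 + 0 * (1 * (1 - 0))) (at_right 0)"
        using u1 \<open>s' < r\<close> by (intro tendsto_add v tendsto_mult[OF tendsto_power_at_right_0]) auto
      moreover have "rank_prob p d (Suc r) (Suc s')
          = p ^ ((d - Suc s') * (r - s')) * (v p + p ^ (r - s') * (u p * (1 - p ^ (d - s'))))" for p
      proof -
        have "(d - Suc s') * (r - Suc s') + (d - Suc s') = (d - Suc s') * (r - s')"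
          using \<open>s' < r\<close> by (metis Suc_diff_Suc add.commute mult_Suc_right)
        moreover have "(d - s') * (r - s') = (d - Suc s') * (r - s') + (r - s')"
          using le by (metis Suc_diff_le add.commute diff_Suc_Suc mult_Suc)
        ultimately show ?thesis
          unfolding rank_prob.simps u v by (simp add: algebra_simps flip: power_add)
      qed
      ultimately show ?thesis unfolding leading_power_def s by (auto intro!: exI)
    qed
  qed
qed

lemma leading_power_prod:
  assumes "finite K" "\<And>i. i \<in> K \<Longrightarrow> leading_power (f i) (e i)"
  shows "leading_power (\<lambda>p. \<Prod>i\<in>K. f i p) (\<Sum>i\<in>K. e i)"
proof -
  obtain u where u: "\<And>i. i \<in> K \<Longrightarrow> (u i \<longlongrightarrow> 1) (at_right 0)" "\<And>i p. i \<in> K \<Longrightarrow> f i p = p ^ e i * u i p"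
    using assms(2) unfolding leading_power_def by metis
  have "((\<lambda>p. \<Prod>i\<in>K. u i p) \<longlongrightarrow> (\<Prod>i\<in>K. 1)) (at_right 0)" using u by (intro tendsto_prod) auto
  moreover have "(\<Prod>i\<in>K. f i p) = p ^ (\<Sum>i\<in>K. e i) * (\<Prod>i\<in>K. u i p)" for p
    using u(2) by (simp add: prod.distrib power_sum)
  ultimately show ?thesis unfolding leading_power_def by auto
qed

text \<open>Terms of exponent above \<open>n\<close> die in the limit and each remaining one tends
  to 1. Taking \<open>n\<close> merely as a lower bound allows two families to be compared before
  their minima are known to agree.\<close>

lemma leading_coeff_tendsto:
  assumes "finite R" "\<And>r. r \<in> R \<Longrightarrow> leading_power (f r) (e r)" "\<And>r. r \<in> R \<Longrightarrow> n \<le> e r"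
  shows "((\<lambda>p. (\<Sum>r\<in>R. f r p) / p ^ n) \<longlongrightarrow> card {r \<in> R. e r = n}) (at_right 0)"
proof -
  obtain u where u: "\<And>r. r \<in> R \<Longrightarrow> (u r \<longlongrightarrow> 1) (at_right 0)" "\<And>r p. r \<in> R \<Longrightarrow> f r p = p ^ e r * u r p"
    using assms(2) unfolding leading_power_def by metis
  have "((\<lambda>p. p ^ (e r - n) * u r p) \<longlongrightarrow> (if e r = n then 1 else 0)) (at_right 0)" if "r \<in> R" for r
  proof (cases "e r = n")
    case False
    then have "((\<lambda>p. p ^ (e r - n) * u r p) \<longlongrightarrow> 0 * 1) (at_right 0)"
      using assms(3)[OF that] u(1)[OF that] by (intro tendsto_mult tendsto_power_at_right_0) auto
    then show ?thesis using False by simp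
  qed (use u(1)[OF that] in simp)
  then have "((\<lambda>p. \<Sum>r\<in>R. p ^ (e r - n) * u r p) \<longlongrightarrow> (\<Sum>r\<in>R. if e r = n then 1 else 0)) (at_right 0)"
    by (intro tendsto_sum) auto
  moreover have "(\<Sum>r\<in>R. if e r = n then 1 else 0) = real (card {r \<in> R. e r = n})"
    using assms(1) by (simp add: sum.If_cases Int_def)
  moreover have "\<forall>\<^sub>F p in at_right 0. (\<Sum>r\<in>R. p ^ (e r - n) * u r p) = (\<Sum>r\<in>R. f r p) / p ^ n"
    using eventually_at_right_less[of 0]
  proof eventually_elim
    case (elim p)
    have "f r p / p ^ n = p ^ (e r - n) * u r p" if "r \<in> R" for r
      using u(2)[OF that, of p] assms(3)[OF that] elim by (simp add: power_diff)
    then show ?case by (simp add: sum_divide_distrib)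
  qed
  ultimately show ?thesis using Lim_transform_eventually by fastforce
qed

lemma min_exponent_unique:
  assumes "finite R" "R \<noteq> {}" "\<And>r. r \<in> R \<Longrightarrow> leading_power (f r) (e r)"
    and "finite R'" "R' \<noteq> {}" "\<And>r. r \<in> R' \<Longrightarrow> leading_power (f' r) (e' r)"
    and eq: "\<And>p. 0 < p \<Longrightarrow> p < 1 \<Longrightarrow> (\<Sum>r\<in>R. f r p) = (\<Sum>r\<in>R'. f' r p)"
  shows "Min (e ` R) = Min (e' ` R') \<and>
    card {r \<in> R. e r = Min (e ` R)} = card {r \<in> R'. e' r = Min (e' ` R')}"
proof -
  \<comment> \<open>At the smaller of the two minima both counts are the same limit; one of them is
    nonzero, so both minima equal \<open>n\<close>.\<close>
  define n where "n = min (Min (e ` R)) (Min (e' ` R'))"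
  have ge: "n \<le> e r" if "r \<in> R" for r
    using that assms(1) unfolding n_def by (meson Min_le finite_imageI imageI min.coboundedI1)
  have ge': "n \<le> e' r" if "r \<in> R'" for r
    using that assms(4) unfolding n_def by (meson Min_le finite_imageI imageI min.coboundedI2)
  have ev: "\<forall>\<^sub>F p in at_right (0::real). (\<Sum>r\<in>R. f r p) / p ^ n = (\<Sum>r\<in>R'. f' r p) / p ^ n"
    using eventually_at_right_real[of 0 1] eq by (auto elim!: eventually_mono)
  have "((\<lambda>p. (\<Sum>r\<in>R. f r p) / p ^ n) \<longlongrightarrow> card {r \<in> R. e r = n}) (at_right 0)"
    using leading_coeff_tendsto[of R f e n] assms(1,3) ge by blast
  then have lim: "((\<lambda>p. (\<Sum>r\<in>R'. f' r p) / p ^ n) \<longlongrightarrow> card {r \<in> R. e r = n}) (at_right 0)"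
    by (rule Lim_transform_eventually[OF _ ev])
  have lim': "((\<lambda>p. (\<Sum>r\<in>R'. f' r p) / p ^ n) \<longlongrightarrow> card {r \<in> R'. e' r = n}) (at_right 0)"
    using leading_coeff_tendsto[of R' f' e' n] assms(4,6) ge' by blast
  have "real (card {r \<in> R. e r = n}) = card {r \<in> R'. e' r = n}"
    using tendsto_unique[OF _ lim lim'] by simp
  then have card: "card {r \<in> R. e r = n} = card {r \<in> R'. e' r = n}" by simp
  have "Min (e ` R) \<in> e ` R" "Min (e' ` R') \<in> e' ` R'" using assms by (auto intro!: Min_in)
  then have "{r \<in> R. e r = n} \<noteq> {} \<or> {r \<in> R'. e' r = n} \<noteq> {}" unfolding n_def min_def by auto
  then have "card {r \<in> R. e r = n} \<noteq> 0" "card {r \<in> R'. e' r = n} \<noteq> 0"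
  proof -
    have "finite {r \<in> R. e r = n}" "finite {r \<in> R'. e' r = n}" using assms(1,4) by auto
    then show "card {r \<in> R. e r = n} \<noteq> 0" "card {r \<in> R'. e' r = n} \<noteq> 0"
      using card \<open>{r \<in> R. e r = n} \<noteq> {} \<or> {r \<in> R'. e' r = n} \<noteq> {}\<close> card_0_eq by metis+
  qed
  then have "{r \<in> R. e r = n} \<noteq> {}" "{r \<in> R'. e' r = n} \<noteq> {}" by (metis card.empty)+
  then obtain x y where "x \<in> R" "e x = n" "y \<in> R'" "e' y = n" by blast
  then have "n \<in> e ` R" "n \<in> e' ` R'" by (metis imageI)+
  then have "Min (e ` R) = n" "Min (e' ` R') = n"
    using ge ge' assms(1,4) by (auto intro!: Min_eqI)
  then show ?thesis using card by simp
qed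

lemma stratum_codim_permute:
  assumes "mset (map d [0..<Suc N]) = mset (map d' [0..<Suc N])"
    and "rank_seqs N d \<noteq> {}" "rank_seqs N d' \<noteq> {}"
  shows "Min (stratum_codim N d ` rank_seqs N d) = Min (stratum_codim N d' ` rank_seqs N d') \<and>
    card {r \<in> rank_seqs N d. stratum_codim N d r = Min (stratum_codim N d ` rank_seqs N d)} =
    card {r \<in> rank_seqs N d'. stratum_codim N d' r = Min (stratum_codim N d' ` rank_seqs N d')}"
proof (rule min_exponent_unique)
  have lead: "leading_power (\<lambda>p. \<Prod>i=1..N. rank_prob p (d i) (r (i - 1)) (r i)) (stratum_codim N d r)"
    if "r \<in> rank_seqs N d" for r d
    unfolding stratum_codim_def
  proof (rule leading_power_prod)
    fix i assume i: "i \<in> {1..N}"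
    then have "r i \<le> r (i - 1)" "r i \<le> d i"
      using rank_seqs_Suc_le[OF that, of "i - 1"] rank_seqs_le[OF that, of i] by auto
    then show "leading_power (\<lambda>p. rank_prob p (d i) (r (i - 1)) (r i)) ((d i - r i) * (r (i - 1) - r i))"
      by (intro leading_power_rank_prob)
  qed simp
  show "leading_power (\<lambda>p. \<Prod>i=1..N. rank_prob p (d i) (r (i - 1)) (r i)) (stratum_codim N d r)"
    if "r \<in> rank_seqs N d" for r using lead[OF that] .
  show "leading_power (\<lambda>p. \<Prod>i=1..N. rank_prob p (d' i) (r (i - 1)) (r i)) (stratum_codim N d' r)"
    if "r \<in> rank_seqs N d'" for r using lead[OF that] .
  show "(\<Sum>r\<in>rank_seqs N d. \<Prod>i=1..N. rank_prob p (d i) (r (i - 1)) (r i))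
      = (\<Sum>r\<in>rank_seqs N d'. \<Prod>i=1..N. rank_prob p (d' i) (r (i - 1)) (r i))" if "0 < p" "p < 1" for p
    using product_rank_prob_permute[OF that assms(1), of 0]
    unfolding rank_seqs_eq_rank_paths product_rank_prob_eq_sum_paths .
qed (use assms finite_rank_seqs in auto)

section \<open>The sorted dimension vector and the integer program\<close>

lemma dsorted_mono:
  assumes "i \<le> j" "j \<le> N"
  shows "dsorted N d i \<le> dsorted N d j"
  unfolding dsorted_def using assms by (intro sorted_nth_mono) (auto simp del: upt_Suc)

lemma mset_dsorted: "mset (map (dsorted N d) [0..<Suc N]) = mset (map d [0..<Suc N])"
proof -
  have "map (dsorted N d) [0..<Suc N] = sort (map d [0..<Suc N])"
    by (rule nth_equalityI) (auto simp: dsorted_def simp del: upt_Suc)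
  then show ?thesis by (simp del: upt_Suc)
qed

text \<open>The increments of the sorted vector telescope, and monotonicity keeps every subtraction
  of naturals exact.\<close>

lemma Gobj_eq:
  assumes e: "e \<in> feasible N d"
  shows "Gobj N d e = (\<Sum>i=1..N. e i * ((\<Sum>j=1..i. e j) + (dsorted N d i - dsorted N d 0)))"
proof -
  have "(\<Sum>j=1..i. e j + dsorted N d j - dsorted N d (j - 1)) = (\<Sum>j=1..i. e j) + (dsorted N d i - dsorted N d 0)"
    if "i \<le> N" for i
    using that
  proof (induction i)
    case (Suc i)
    then show ?case using dsorted_mono[of i "Suc i" N d] dsorted_mono[of 0 i N d] by simp
  qed simp
  then show ?thesis unfolding Gobj_def by (intro sum.cong) (auto simp: sum_distrib_left[symmetric])
qed

text \<open>The variables \<open>e k\<close> are the rank drops. Sortedness makes the bound of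
  \<open>r k\<close> by the \<open>k\<close>-th dimension automatic, since ranks never exceed the
  smallest dimension; only nonnegativity and the total drop remain as constraints.\<close>

lemma feasible_bij_rank_seqs:
  defines "\<rho> \<equiv> (\<lambda>N d e k. if k \<le> N then dsorted N d 0 - (\<Sum>j=1..k. e j) else 0)"
  shows "bij_betw (\<rho> N d) (feasible N d) (rank_seqs N (dsorted N d))"
    and "e \<in> feasible N d \<Longrightarrow> stratum_codim N (dsorted N d) (\<rho> N d e) = Gobj N d e"
proof -
  let ?d = "dsorted N d"
  have part: "(\<Sum>j=1..k. e j) \<le> ?d 0" if "e \<in> feasible N d" "k \<le> N" for e k
  proof -
    have "(\<Sum>j=1..k. e j) \<le> (\<Sum>j=1..N. e j)" using that by (intro sum_mono2) auto
    then show ?thesis using that unfolding feasible_def by simp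
  qed
  have diff: "\<rho> N d e (k - 1) - \<rho> N d e k = e k" if e: "e \<in> feasible N d" and "1 \<le> k" "k \<le> N" for e k
  proof -
    obtain k' where "k = Suc k'" using \<open>1 \<le> k\<close> by (cases k) auto
    then show ?thesis using part[OF e, of k] that unfolding \<rho>_def by simp
  qed
  show "bij_betw (\<rho> N d) (feasible N d) (rank_seqs N ?d)"
  proof (rule bij_betw_byWitness[where f' = "\<lambda>r k. if 1 \<le> k \<and> k \<le> N then r (k - 1) - r k else 0"])
    show "\<forall>e\<in>feasible N d. (\<lambda>k. if 1 \<le> k \<and> k \<le> N then \<rho> N d e (k - 1) - \<rho> N d e k else 0) = e"
      using diff by (auto simp: fun_eq_iff feasible_def not_le)
    have tel: "(\<Sum>j=1..k. if 1 \<le> j \<and> j \<le> N then r (j - 1) - r j else 0) + r k = r 0"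
      if r: "r \<in> rank_seqs N ?d" and "k \<le> N" for r k
      using \<open>k \<le> N\<close>
    proof (induction k)
      case (Suc k)
      then show ?case using rank_seqs_Suc_le[OF r, of k] by simp
    qed simp
    show "\<forall>r\<in>rank_seqs N ?d. \<rho> N d (\<lambda>k. if 1 \<le> k \<and> k \<le> N then r (k - 1) - r k else 0) = r"
    proof (intro ballI ext)
      fix r k assume r: "r \<in> rank_seqs N ?d"
      show "\<rho> N d (\<lambda>k. if 1 \<le> k \<and> k \<le> N then r (k - 1) - r k else 0) k = r k"
      proof (cases "k \<le> N")
        case True
        then show ?thesis using tel[OF r True] rank_seqs_0[OF r] unfolding \<rho>_def by simp
      next
        case False
        then show ?thesis using r unfolding \<rho>_def rank_seqs_def by simp
      qed
    qed
    show "\<rho> N d ` feasible N d \<subseteq> rank_seqs N ?d"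
    proof clarify
      fix e assume e: "e \<in> feasible N d"
      have "\<rho> N d e (Suc k) \<le> ?d (Suc k)" if "k < N" for k
        using dsorted_mono[of 0 "Suc k" N d] that unfolding \<rho>_def by simp
      then show "\<rho> N d e \<in> rank_seqs N ?d"
        using e unfolding rank_seqs_def feasible_def by (auto simp: \<rho>_def)
    qed
    show "(\<lambda>r k. if 1 \<le> k \<and> k \<le> N then r (k - 1) - r k else 0) ` rank_seqs N ?d \<subseteq> feasible N d"
    proof clarify
      fix r assume r: "r \<in> rank_seqs N ?d"
      then have "r N = 0" unfolding rank_seqs_def by simp
      then show "(\<lambda>k. if 1 \<le> k \<and> k \<le> N then r (k - 1) - r k else 0) \<in> feasible N d"
        using tel[OF r order.refl] rank_seqs_0[OF r] unfolding feasible_def by auto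
    qed
  qed
  show "stratum_codim N ?d (\<rho> N d e) = Gobj N d e" if e: "e \<in> feasible N d"
    unfolding Gobj_eq[OF e] stratum_codim_def
  proof (rule sum.cong)
    fix k assume k: "k \<in> {1..N}"
    have "?d k - \<rho> N d e k = (\<Sum>j=1..k. e j) + (?d k - ?d 0)"
      using part[OF e, of k] dsorted_mono[of 0 k N d] k unfolding \<rho>_def by simp
    then show "(?d k - \<rho> N d e k) * (\<rho> N d e (k - 1) - \<rho> N d e k) = e k * ((\<Sum>j=1..k. e j) + (?d k - ?d 0))"
      using diff[OF e] k by (simp add: mult.commute)
  qed simp
qed

lemma stratum_codim_dsorted:
  shows "Min (stratum_codim N (dsorted N d) ` rank_seqs N (dsorted N d)) = Min (Gobj N d ` feasible N d)"
    and "card {r \<in> rank_seqs N (dsorted N d). stratum_codim N (dsorted N d) r = m}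
      = card {e \<in> feasible N d. Gobj N d e = m}"
proof -
  obtain \<rho> where bij: "bij_betw \<rho> (feasible N d) (rank_seqs N (dsorted N d))"
    and val: "\<And>e. e \<in> feasible N d \<Longrightarrow> stratum_codim N (dsorted N d) (\<rho> e) = Gobj N d e"
    using feasible_bij_rank_seqs by blast
  have img: "rank_seqs N (dsorted N d) = \<rho> ` feasible N d" using bij by (simp add: bij_betw_def)
  show "Min (stratum_codim N (dsorted N d) ` rank_seqs N (dsorted N d)) = Min (Gobj N d ` feasible N d)"
    unfolding img image_image using val by (intro arg_cong[of _ _ Min] image_cong) auto
  have "bij_betw \<rho> {e \<in> feasible N d. Gobj N d e = m}
      {r \<in> rank_seqs N (dsorted N d). stratum_codim N (dsorted N d) r = m}"
  proof (rule bij_betw_imageI)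
    show "inj_on \<rho> {e \<in> feasible N d. Gobj N d e = m}"
      by (rule inj_on_subset[OF bij_betw_imp_inj_on[OF bij]]) auto
    show "\<rho> ` {e \<in> feasible N d. Gobj N d e = m}
        = {r \<in> rank_seqs N (dsorted N d). stratum_codim N (dsorted N d) r = m}"
      unfolding img using val by auto
  qed
  then show "card {r \<in> rank_seqs N (dsorted N d). stratum_codim N (dsorted N d) r = m}
      = card {e \<in> feasible N d. Gobj N d e = m}"
    by (rule bij_betw_same_card[symmetric])
qed

theorem theorem6:
  fixes N :: nat and d :: "nat \<Rightarrow> nat"
  assumes "1 \<le> N"
  shows "zdim N d (Rep N d) - zdim N d (Sigma0 N d) = Min (Gobj N d ` feasible N d)
     \<and> card (top_components N d (Sigma0 N d))
         = card {e \<in> feasible N d. Gobj N d e = Min (Gobj N d ` feasible N d)}"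
  unfolding codim_Sigma0[OF assms] card_top_components_Sigma0[OF assms]
  using stratum_codim_permute[OF mset_dsorted[symmetric] rank_seqs_nonempty[OF assms] rank_seqs_nonempty[OF assms], of d]
  unfolding stratum_codim_dsorted .

end
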